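(* Let $d\ge2$ and $q\ge0$ be integers. For every $w\in\mathbb{S}^{d-1}$, the leverage function $$\tau_q(w):=\max_{g\in L^2(\mathbb{S}^{d-1})}\left\|\mathcal{K}_d^{(q)}g\right\|_{\mathbb{S}^{d-1}}^{-2}\cdot\left|\left[\mathcal{K}_d^{(q)}g\right](w)\right|^2$$ satisfies $$\tau_q(w)=\sum_{\ell=0}^q\frac{\alpha_{\ell,d}}{|\mathbb{S}^{d-1}|}.$$
   Context: $\mathbb{S}^{d-1}$ is the unit sphere in $\mathbb{R}^d$, $|\mathbb{S}^{d-1}|=\frac{2\pi^{d/2}}{\Gamma(d/2)}$ its surface area, $\mathcal{U}(\mathbb{S}^{d-1})$ the uniform probability distribution on it. $L^2(\mathbb{S}^{d-1})$ is the Hilbert space of real square-integrable functions with $\langle f,g\rangle_{\mathbb{S}^{d-1}}=\int_{\mathbb{S}^{d-1}}f(w)g(w)\,dw=|\mathbb{S}^{d-1}|\cdot\mathbb{E}_{w\sim\mathcal{U}(\mathbb{S}^{d-1})}[f(w)g(w)]$ and norm $\|f\|_{\mathbb{S}^{d-1}}=\sqrt{\langle f,f\rangle_{\mathbb{S}^{d-1}}}$. $\alpha_{\ell,d}$ is the dimension of the space of spherical harmonics of degree $\ell$ on $\mathbb{S}^{d-1}$ (restrictions of real homogeneous harmonic polynomials of degree $\ell$ in $d$ variables): $\alpha_{0,d}=1$, $\alpha_{1,d}=d$, $\alpha_{\ell,d}=\binom{d+\ell-1}{\ell}-\binom{d+\ell-3}{\ell-2}$ for $\ell\ge2$. The Gegenbauer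 polynomial of degree $\ell$ in dimension $d\ge2$ is $P_d^\ell(t)=\sum_{j=0}^{\lfloor\ell/2\rfloor}c_j\,t^{\ell-2j}(1-t^2)^j$ with $c_0=1$ and $c_{j+1}=-\frac{(\ell-2j)(\ell-2j-1)}{2(j+1)(d-1+2j)}c_j$. The operator $\mathcal{K}_d^{(q)}:L^2(\mathbb{S}^{d-1})\to L^2(\mathbb{S}^{d-1})$ is $[\mathcal{K}_d^{(q)}f](\sigma)=\sum_{\ell=0}^q\alpha_{\ell,d}\,\mathbb{E}_{w\sim\mathcal{U}(\mathbb{S}^{d-1})}[f(w)P_d^\ell(\langle\sigma,w\rangle)]$, where $[\mathcal{K}_d^{(q)}f](\sigma)$ is defined pointwise by this formula. The maximum defining $\tau_q(w)$ is over $g$ with $\mathcal{K}_d^{(q)}g\neq0$. *)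

theory Defs
  imports "HOL-Probability.Probability"
begin

text \<open>
  The uniform distribution on the unit sphere: the law of \<open>x / \<parallel>x\<parallel>\<close> for \<open>x\<close> uniform in the unit
  ball (the null event \<open>x = 0\<close>, where \<open>sgn 0 = 0\<close>, is removed by restricting to the sphere).
\<close>

definition sphere_uniform :: "'a::euclidean_space measure" where
  "sphere_uniform =
     restrict_space (distr (uniform_measure lborel (ball 0 1)) borel sgn) (sphere 0 1)"

lemma space_sphere_uniform: "space (sphere_uniform :: 'a::euclidean_space measure) = sphere 0 1"
  by (simp add: sphere_uniform_def space_restrict_space)

lemma sets_sphere_uniform:
  "sets (sphere_uniform :: 'a::euclidean_space measure) = sets (restrict_space borel (sphere 0 1))"
  by (simp add: sphere_uniform_def sets_restrict_space)

lemma prob_space_sphere_uniform: "prob_space (sphere_uniform :: 'a::euclidean_space measure)"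
proof -
  let ?U = "uniform_measure lborel (ball (0::'a) 1)"
  have pos: "emeasure lborel (ball (0::'a) 1) \<noteq> 0"
    using emeasure_lborel_ball_finite[of "0::'a" 1] content_ball_pos[of 1 "0::'a"]
    by (auto simp: measure_def)
  have "emeasure lborel (ball (0::'a) 1) < \<infinity>"
    by (rule emeasure_lborel_ball_finite)
  then interpret U: prob_space ?U
    using pos by (intro prob_space_uniform_measure) auto
  have meas: "(sgn :: 'a \<Rightarrow> 'a) \<in> measurable ?U borel"
    unfolding sgn_div_norm by measurable
  interpret D: prob_space "distr ?U borel (sgn :: 'a \<Rightarrow> 'a)"
    by (rule U.prob_space_distr[OF meas])
  have "AE x in lborel. x \<noteq> (0::'a)"
    by (rule AE_lborel_singleton)
  then have "AE x in ?U. x \<noteq> (0::'a)"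
    by (intro AE_uniform_measureI) auto
  then have "AE x in ?U. sgn x \<in> sphere (0::'a) 1"
    by eventually_elim (simp add: norm_sgn)
  then have "AE x in distr ?U borel sgn. x \<in> sphere (0::'a) 1"
    by (subst AE_distr_iff[OF meas]) simp_all
  then have "emeasure (distr ?U borel sgn) (sphere (0::'a) 1) = 1"
    by (intro D.emeasure_eq_1_AE) simp_all
  then show ?thesis
    by (intro prob_spaceI)
      (simp add: space_sphere_uniform, simp add: sphere_uniform_def emeasure_restrict_space)
qed

definition sphere_area :: "nat \<Rightarrow> real" where
  "sphere_area d = 2 * pi powr (real d / 2) / Gamma (real d / 2)"

text \<open>
  Elements of \<open>L\<^sup>2\<close> are represented by functions on the ambient space; values off the sphere are
  irrelevant, and two functions represent the same element iff they agree almost everywhere.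
\<close>

definition sphere_L2 :: "('a::euclidean_space \<Rightarrow> real) set" where
  "sphere_L2 = {f \<in> borel_measurable sphere_uniform. integrable sphere_uniform (\<lambda>x. (f x)\<^sup>2)}"

definition sphere_inner :: "('a::euclidean_space \<Rightarrow> real) \<Rightarrow> ('a \<Rightarrow> real) \<Rightarrow> real" where
  "sphere_inner f g = sphere_area DIM('a) * (\<integral>x. f x * g x \<partial>sphere_uniform)"

definition sphere_norm :: "('a::euclidean_space \<Rightarrow> real) \<Rightarrow> real" where
  "sphere_norm f = sqrt (sphere_inner f f)"

text \<open>
  The dimension of the space of spherical harmonics of degree \<open>l\<close> on the unit sphere of
  \<open>d\<close>-dimensional space, in closed form; real-valued so that the difference is not truncated.
\<close>

definition harmonic_dim :: "nat \<Rightarrow> nat \<Rightarrow> real" where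
  "harmonic_dim l d =
     (if l = 0 then 1 else if l = 1 then real d
      else real ((d + l - 1) choose l) - real ((d + l - 3) choose (l - 2)))"

text \<open>Normalised so that the value at \<open>t = 1\<close> is \<open>1\<close>, not as the classical ultraspherical polynomials.\<close>

fun gegenbauer_coeff :: "nat \<Rightarrow> nat \<Rightarrow> nat \<Rightarrow> real" where
  "gegenbauer_coeff d l 0 = 1"
| "gegenbauer_coeff d l (Suc j) =
     - ((real l - 2 * real j) * (real l - 2 * real j - 1)
        / (2 * (real j + 1) * (real d - 1 + 2 * real j))) * gegenbauer_coeff d l j"

definition gegenbauer :: "nat \<Rightarrow> nat \<Rightarrow> real \<Rightarrow> real" where
  "gegenbauer d l t =
     (\<Sum>j = 0..l div 2. gegenbauer_coeff d l j * t ^ (l - 2 * j) * (1 - t\<^sup>2) ^ j)"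

definition harmonic_op :: "nat \<Rightarrow> ('a::euclidean_space \<Rightarrow> real) \<Rightarrow> 'a \<Rightarrow> real" where
  "harmonic_op q f \<sigma> =
     (\<Sum>l = 0..q. harmonic_dim l DIM('a) *
        (\<integral>w. f w * gegenbauer DIM('a) l (\<sigma> \<bullet> w) \<partial>sphere_uniform))"

text \<open>The condition \<open>\<not> (AE \<sigma> \<dots>)\<close> says that the image of \<open>g\<close> is nonzero as an element of \<open>L\<^sup>2\<close>.\<close>

definition leverage_values :: "nat \<Rightarrow> 'a::euclidean_space \<Rightarrow> real set" where
  "leverage_values q w =
     {sphere_norm (harmonic_op q g) powi (-2) * \<bar>harmonic_op q g w\<bar>\<^sup>2 | g.
        g \<in> sphere_L2 \<and> \<not> (AE \<sigma> in sphere_uniform. harmonic_op q g \<sigma> = 0)}"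

text \<open>\<open>Greatest\<close> is unspecified if no maximum exists, so existence has to be asserted separately.\<close>

definition leverage :: "nat \<Rightarrow> 'a::euclidean_space \<Rightarrow> real" where
  "leverage q w = (GREATEST t. t \<in> leverage_values q w)"

end

theory Submission
  imports Defs "HOL-Computational_Algebra.Polynomial"
begin

text \<open>
  Write \<open>d\<close> for the dimension, \<open>\<alpha>\<^sub>l\<close> for \<open>harmonic_dim l d\<close>, \<open>P\<^sub>l\<close> for the Gegenbauer polynomials and
  \<open>K = (\<Sum>l\<le>q. \<alpha>\<^sub>l P\<^sub>l)\<close>. The operator has the kernel \<open>K (\<sigma> \<bullet> w)\<close>, and the claim is that of any
  reproducing kernel: if averaging \<open>K (u \<bullet> v) K (v \<bullet> w)\<close> over \<open>v\<close> gives back \<open>K (u \<bullet> w)\<close>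
  (\<open>harmonic_kernel_reproducing\<close>), then every function \<open>h\<close> in the image satisfies
  \<open>h w = (\<integral>x. K (w \<bullet> x) h x)\<close>. Cauchy-Schwarz bounds \<open>(h w)\<^sup>2\<close> by \<open>K 1\<close> times the mean of \<open>h\<^sup>2\<close>, and
  the function \<open>K (w \<bullet> _)\<close> itself attains the bound. As \<open>P\<^sub>l 1 = 1\<close>, the constant \<open>K 1\<close> is
  \<open>(\<Sum>l\<le>q. \<alpha>\<^sub>l)\<close>; the surface area enters only through the normalisation of the norm.

  The reproducing identity says that averaging \<open>P\<^sub>m (u \<bullet> v) P\<^sub>l (v \<bullet> w)\<close> over \<open>v\<close> gives
  \<open>P\<^sub>l (u \<bullet> w) / \<alpha>\<^sub>l\<close> if \<open>m = l\<close> and \<open>0\<close> otherwise. It is derived here from the symmetry of the sphere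
  and from one-variable orthogonality, without harmonic functions. By rotation invariance the
  average of \<open>p (u \<bullet> v) r (v \<bullet> w)\<close> is a function \<open>p \<star> r\<close> of \<open>u \<bullet> w\<close> alone, and for polynomials it is a
  polynomial of degree at most that of \<open>r\<close> (\<open>zonal_convolution\<close>). So convolution with a fixed \<open>p\<close> maps
  the polynomials of degree at most \<open>k\<close> to themselves, for every \<open>k\<close>; by Fubini it is self-adjoint for
  the inner product \<open>(\<integral>v. r (u \<bullet> v) s (u \<bullet> v))\<close>. A self-adjoint operator that preserves a flag is
  diagonal in the orthogonal basis adapted to the flag, so every \<open>P\<^sub>l\<close> is an eigenvector
  (\<open>funk_hecke\<close>), and evaluation at \<open>1\<close> gives the eigenvalue.

  The orthogonality of the \<open>P\<^sub>l\<close> and the value \<open>1 / \<alpha>\<^sub>l\<close> of their square norms come from two facts: the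
  three-term recurrence \<open>(2 l + d - 2) t P\<^sub>l = (l + d - 2) P\<^bsub>l+1\<^esub> + l P\<^bsub>l-1\<^esub>\<close>, and the vanishing of the mean
  of \<open>P\<^sub>l (u \<bullet> v)\<close> for \<open>l > 0\<close>, for which the moments of \<open>u \<bullet> v\<close> are computed by rotation invariance.
\<close>

section \<open>Rotation invariance of the uniform distribution on the sphere\<close>

lemma nn_integral_lborel_translate:
  fixes h :: "'a::euclidean_space \<Rightarrow> ennreal"
  assumes [measurable]: "h \<in> borel_measurable borel"
  shows "(\<integral>\<^sup>+y. h (c + y) \<partial>lborel) = (\<integral>\<^sup>+y. h y \<partial>lborel)"
proof -
  have "(\<integral>\<^sup>+y. h y \<partial>lborel) = (\<integral>\<^sup>+y. h y \<partial>distr lborel borel ((+) c))"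
    by (simp add: lborel_distr_plus)
  also have "\<dots> = (\<integral>\<^sup>+y. h (c + y) \<partial>lborel)"
    by (subst nn_integral_distr) auto
  finally show ?thesis ..
qed

lemma nn_integral_lborel_reflect:
  fixes h :: "'a::euclidean_space \<Rightarrow> ennreal"
  assumes [measurable]: "h \<in> borel_measurable borel"
  shows "(\<integral>\<^sup>+x. h (c - x) \<partial>lborel) = (\<integral>\<^sup>+x. h x \<partial>lborel)"
proof -
  have eq: "distr lborel borel (\<lambda>x::'a. - x) = lborel"
    using lborel_affine[of "-1" "0::'a"] by (simp add: density_1)
  have "(\<integral>\<^sup>+x. h x \<partial>lborel) = (\<integral>\<^sup>+x. h (c + x) \<partial>lborel)"
    by (simp add: nn_integral_lborel_translate)
  also have "\<dots> = (\<integral>\<^sup>+x. h (c + x) \<partial>distr lborel borel (\<lambda>x. - x))"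
    by (simp only: eq)
  also have "\<dots> = (\<integral>\<^sup>+x. h (c - x) \<partial>lborel)"
    by (subst nn_integral_distr) auto
  finally show ?thesis ..
qed

lemma orthogonal_transformation_borel_measurable:
  fixes f :: "'a::euclidean_space \<Rightarrow> 'a"
  assumes "orthogonal_transformation f"
  shows "f \<in> borel_measurable borel"
  using assms by (intro borel_measurable_continuous_onI linear_continuous_on)
    (simp add: linear_conv_bounded_linear[symmetric] orthogonal_transformation_linear)

text \<open>
  The two sides are translation-invariant measures, hence proportional, and they agree on the unit
  ball \<open>A\<close>. Proportionality is the usual Fubini argument, applied to the set of pairs \<open>(x, y)\<close> with
  \<open>x \<in> A\<close> and \<open>f y - x \<in> B\<close>: integrating over \<open>y\<close> first gives \<open>|A| |f\<^sup>-\<^sup>1 B|\<close>, and integrating over \<open>x\<close>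
  first, after substituting \<open>f y - x\<close> for \<open>x\<close>, gives \<open>|f\<^sup>-\<^sup>1 A| |B|\<close>.
\<close>

lemma emeasure_lborel_vimage_orthogonal:
  fixes f :: "'a::euclidean_space \<Rightarrow> 'a"
  assumes f: "orthogonal_transformation f" and B[measurable]: "B \<in> sets borel"
  shows "emeasure lborel (f -` B) = emeasure lborel B"
proof -
  note [measurable] = orthogonal_transformation_borel_measurable[OF f]
  let ?A = "ball (0::'a) 1"
  have A[measurable]: "?A \<in> sets borel"
    by simp
  have lin: "linear f" and sur: "surj f" and nrm: "norm (f x) = norm x" for x
    using f by (auto simp: orthogonal_transformation_linear orthogonal_transformation_surj
        orthogonal_transformation_norm)
  have vim: "emeasure lborel (f -` S) = (\<integral>\<^sup>+y. indicator S (f y) \<partial>lborel)"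
    if [measurable]: "S \<in> sets borel" for S
  proof -
    have "f -` S \<in> sets borel"
      using measurable_sets[OF orthogonal_transformation_borel_measurable[OF f] that] by simp
    then have "emeasure lborel (f -` S) = (\<integral>\<^sup>+y. indicator (f -` S) y \<partial>lborel)"
      by simp
    also have "\<dots> = (\<integral>\<^sup>+y. indicator S (f y) \<partial>lborel)"
      by (intro nn_integral_cong) (simp split: split_indicator)
    finally show ?thesis .
  qed
  have shift: "(\<integral>\<^sup>+y. indicator B (f y - x) \<partial>lborel) = emeasure lborel (f -` B)" for x
  proof -
    obtain z where z: "f z = x"
      using sur by (metis surjD)
    have "(\<integral>\<^sup>+y. indicator B (f y - x) \<partial>lborel) = (\<integral>\<^sup>+y. indicator B (f (- z + y)) \<partial>lborel)"
      by (simp add: linear_add[OF lin] linear_neg[OF lin] linear_diff[OF lin] z)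
    also have "\<dots> = (\<integral>\<^sup>+y. indicator B (f y) \<partial>lborel)"
      by (rule nn_integral_lborel_translate[where h = "\<lambda>y. indicator B (f y)"]) measurable
    finally show ?thesis
      by (simp add: vim)
  qed
  (* |A| |f^-1 B| = |f^-1 A| |B|, with |f^-1 A| = |A| entering through norm (f x) = norm x *)
  have "emeasure lborel ?A * emeasure lborel (f -` B)
    = (\<integral>\<^sup>+x. indicator ?A x * emeasure lborel (f -` B) \<partial>lborel)"
    by (subst nn_integral_multc) auto
  also have "\<dots> = (\<integral>\<^sup>+x. (\<integral>\<^sup>+y. indicator ?A x * indicator B (f y - x) \<partial>lborel) \<partial>lborel)"
    by (subst nn_integral_cmult) (auto simp: shift)
  also have "\<dots> = (\<integral>\<^sup>+y. (\<integral>\<^sup>+x. indicator ?A x * indicator B (f y - x) \<partial>lborel) \<partial>lborel)"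
    by (rule lborel_pair.Fubini'[symmetric]) measurable
  also have "\<dots> = (\<integral>\<^sup>+y. (\<integral>\<^sup>+x. indicator ?A (f y - x) * indicator B x \<partial>lborel) \<partial>lborel)"
  proof (rule nn_integral_cong)
    fix y
    show "(\<integral>\<^sup>+x. indicator ?A x * indicator B (f y - x) \<partial>lborel)
        = (\<integral>\<^sup>+x. indicator ?A (f y - x) * indicator B x \<partial>lborel)"
      using nn_integral_lborel_reflect[where c = "f y"
          and h = "\<lambda>x. indicator ?A (f y - x) * indicator B x"]
      by simp
  qed
  also have "\<dots> = (\<integral>\<^sup>+x. (\<integral>\<^sup>+y. indicator ?A (f y - x) * indicator B x \<partial>lborel) \<partial>lborel)"
    by (rule lborel_pair.Fubini') measurable
  also have "\<dots> = (\<integral>\<^sup>+x. emeasure lborel ?A * indicator B x \<partial>lborel)"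
  proof (rule nn_integral_cong)
    fix x
    obtain z where z: "f z = x"
      using sur by (metis surjD)
    have "(\<integral>\<^sup>+y. indicator ?A (f y - x) \<partial>lborel) = (\<integral>\<^sup>+y. indicator ?A (- z + y) \<partial>lborel)"
      by (intro nn_integral_cong) (auto simp: z[symmetric] linear_diff[OF lin, symmetric] nrm split: split_indicator)
    also have "\<dots> = emeasure lborel ?A"
      by (subst nn_integral_lborel_translate[where h = "indicator ?A"]) auto
    finally show "(\<integral>\<^sup>+y. indicator ?A (f y - x) * indicator B x \<partial>lborel)
        = emeasure lborel ?A * indicator B x"
      by (subst nn_integral_multc) auto
  qed
  also have "\<dots> = emeasure lborel ?A * emeasure lborel B"
    by (subst nn_integral_cmult) auto
  finally have eq: "emeasure lborel ?A * emeasure lborel (f -` B) = emeasure lborel ?A * emeasure lborel B" .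
  have "emeasure lborel ?A \<noteq> 0" "emeasure lborel ?A \<noteq> \<infinity>"
    using emeasure_lborel_ball_finite[of "0::'a" 1] content_ball_pos[of 1 "0::'a"]
    by (auto simp: measure_def)
  then show ?thesis
    using eq by (simp add: ennreal_mult_cancel_left)
qed

lemma measurable_sphere_uniform:
  "f \<in> borel_measurable borel \<Longrightarrow> f \<in> borel_measurable (sphere_uniform :: 'a::euclidean_space measure)"
  by (subst measurable_cong_sets[OF sets_sphere_uniform refl]) (rule measurable_restrict_space1)

text \<open>
  An orthogonal map commutes with the normalisation \<open>sgn\<close> and preserves the ball, so the invariance
  of Lebesgue measure carries over to the sphere.
\<close>

lemma distr_sphere_uniform_orthogonal:
  fixes f :: "'a::euclidean_space \<Rightarrow> 'a"
  assumes f: "orthogonal_transformation f"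
  shows "distr sphere_uniform sphere_uniform f = sphere_uniform"
proof (rule measure_eqI)
  have [measurable]: "f \<in> borel_measurable borel"
    by (rule orthogonal_transformation_borel_measurable[OF f])
  have [measurable]: "(sgn :: 'a \<Rightarrow> 'a) \<in> borel_measurable borel"
    unfolding sgn_div_norm by measurable
  have nrm: "norm (f x) = norm x" for x
    using f by (rule orthogonal_transformation_norm)
  have fsgn: "f (sgn x) = sgn (f x)" for x
    by (simp add: sgn_div_norm nrm orthogonal_transformation_scaleR[OF f])
  have fM: "f \<in> measurable sphere_uniform (sphere_uniform :: 'a measure)"
    unfolding measurable_cong_sets[OF sets_sphere_uniform sets_sphere_uniform]
    by (rule measurable_restrict_space3) (auto simp: nrm)
  fix A assume "A \<in> sets (distr sphere_uniform sphere_uniform f)"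
  then have AM: "A \<in> sets (sphere_uniform :: 'a measure)"
    by simp
  then have A[measurable]: "A \<in> sets borel" and AS: "A \<subseteq> sphere 0 1"
    by (auto simp: sets_sphere_uniform sets_restrict_space_iff)
  have U: "emeasure sphere_uniform S = emeasure lborel (ball 0 1 \<inter> sgn -` S) / emeasure lborel (ball (0::'a) 1)"
    if S: "S \<in> sets borel" "S \<subseteq> sphere 0 1" for S :: "'a set"
    using S measurable_sets[of sgn borel borel S]
    by (simp add: sphere_uniform_def emeasure_restrict_space emeasure_distr)
  have fS: "f -` A \<in> sets borel"
    using measurable_sets[of f borel borel A] A by simp
  have fS': "f -` A \<subseteq> sphere 0 1"
  proof
    fix x assume "x \<in> f -` A"
    then have "f x \<in> sphere 0 1" using AS by blast
    then show "x \<in> sphere 0 1" by (simp add: nrm)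
  qed
  have "emeasure (distr sphere_uniform sphere_uniform f) A = emeasure sphere_uniform (f -` A \<inter> sphere 0 1)"
    by (simp add: emeasure_distr[OF fM AM] space_sphere_uniform)
  also have "f -` A \<inter> sphere 0 1 = f -` A"
    using fS' by blast
  also have "emeasure sphere_uniform (f -` A)
      = emeasure lborel (f -` (ball 0 1 \<inter> sgn -` A)) / emeasure lborel (ball (0::'a) 1)"
    unfolding U[OF fS fS'] by (intro arg_cong2[where f="(/)"] arg_cong[where f="emeasure lborel"] refl)
      (auto simp: nrm fsgn)
  also have "emeasure lborel (f -` (ball 0 1 \<inter> sgn -` A)) = emeasure lborel (ball 0 1 \<inter> sgn -` A)"
    using measurable_sets[of sgn borel borel A] A
    by (intro emeasure_lborel_vimage_orthogonal[OF f]) simp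
  finally show "emeasure (distr sphere_uniform sphere_uniform f) A = emeasure sphere_uniform A"
    by (simp add: U[OF A AS])
qed simp

text \<open>
  The reflection in the hyperplane orthogonal to \<open>u - u'\<close>. That it fixes this hyperplane
  pointwise is what allows two such reflections to be composed for a pair of vectors.
\<close>

lemma exists_reflection:
  fixes u u' :: "'a::euclidean_space"
  assumes n: "norm u = norm u'"
  obtains f where "orthogonal_transformation f" "f u = u'" "\<And>x. x \<bullet> u = x \<bullet> u' \<Longrightarrow> f x = x"
proof -
  define a where "a = u - u'"
  define c where "c = 2 / (a \<bullet> a)"
  define f where "f x = x - (c * (a \<bullet> x)) *\<^sub>R a" for x
  have cc: "c * c * (a \<bullet> a) = 2 * c"
    by (simp add: c_def)
  have "linear f"
    unfolding f_def by (intro linearI) (simp_all add: inner_add_right algebra_simps)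
  moreover have "f x \<bullet> f y = x \<bullet> y" for x y
  proof -
    have "f x \<bullet> f y = x \<bullet> y + (c * c * (a \<bullet> a) - 2 * c) * ((a \<bullet> x) * (a \<bullet> y))"
      unfolding f_def by (simp add: inner_diff_left inner_diff_right inner_commute[of x a] algebra_simps)
    then show ?thesis
      by (simp add: cc)
  qed
  ultimately have "orthogonal_transformation f"
    by (simp add: orthogonal_transformation_def)
  moreover have "f u = u'"
  proof (cases "a = 0")
    case False
    have "u \<bullet> u = u' \<bullet> u'"
      using n by (simp add: norm_eq_sqrt_inner)
    then have "2 * (a \<bullet> u) = a \<bullet> a"
      by (simp add: a_def inner_diff_left inner_diff_right inner_commute)
    then show ?thesis
      using False by (simp add: f_def c_def a_def)
  qed (simp add: f_def a_def)
  moreover have "f x = x" if "x \<bullet> u = x \<bullet> u'" for x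
  proof -
    have "a \<bullet> x = 0"
      using that by (simp add: a_def inner_diff_left inner_commute[of x u] inner_commute[of x u'])
    then show ?thesis
      by (simp add: f_def)
  qed
  ultimately show ?thesis
    using that by blast
qed

lemma exists_orthogonal_transformation_pair:
  fixes u w u' w' :: "'a::euclidean_space"
  assumes "norm u = norm u'" "norm w = norm w'" "u \<bullet> w = u' \<bullet> w'"
  obtains f where "orthogonal_transformation f" "f u = u'" "f w = w'"
proof -
  obtain f where f: "orthogonal_transformation f" "f u = u'"
    using exists_reflection[OF assms(1)] by metis
  have "norm (f w) = norm w'"
    using f assms(2) by (simp add: orthogonal_transformation_norm)
  then obtain g where g: "orthogonal_transformation g" "g (f w) = w'"
      "\<And>x. x \<bullet> f w = x \<bullet> w' \<Longrightarrow> g x = x"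
    using exists_reflection[of "f w" w'] by metis
  have "u' \<bullet> f w = u' \<bullet> w'"
    using f assms(3) by (auto simp: orthogonal_transformation_def)
  then have "g (f u) = u'"
    using g(3) f(2) by simp
  then show ?thesis
    using that[of "g \<circ> f"] orthogonal_transformation_compose[OF g(1) f(1)] g(2) by simp
qed

text \<open>
  Averages over the sphere see a pair of vectors only through its Gram matrix. Every use of the
  symmetry of the sphere below goes through this lemma.
\<close>

lemma sphere_integral_pair_cong:
  fixes u w u' w' :: "'a::euclidean_space" and F :: "real \<Rightarrow> real \<Rightarrow> real"
  assumes "norm u = norm u'" "norm w = norm w'" "u \<bullet> w = u' \<bullet> w'"
    and F[measurable]: "case_prod F \<in> borel_measurable (borel \<Otimes>\<^sub>M borel)"
  shows "(\<integral>v. F (u \<bullet> v) (w \<bullet> v) \<partial>sphere_uniform) = (\<integral>v. F (u' \<bullet> v) (w' \<bullet> v) \<partial>sphere_uniform)"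
proof -
  obtain f where f: "orthogonal_transformation f" "f u = u'" "f w = w'"
    using exists_orthogonal_transformation_pair[OF assms(1-3)] .
  have dot: "f x \<bullet> f y = x \<bullet> y" for x y
    using f(1) by (simp add: orthogonal_transformation_def)
  have fM: "f \<in> measurable sphere_uniform sphere_uniform"
    unfolding measurable_cong_sets[OF sets_sphere_uniform sets_sphere_uniform]
    by (rule measurable_restrict_space3[OF orthogonal_transformation_borel_measurable[OF f(1)]])
      (auto simp: orthogonal_transformation_norm[OF f(1)])
  have "(\<integral>v. F (u' \<bullet> v) (w' \<bullet> v) \<partial>sphere_uniform)
      = (\<integral>v. F (u' \<bullet> v) (w' \<bullet> v) \<partial>distr sphere_uniform sphere_uniform f)"
    by (simp add: distr_sphere_uniform_orthogonal[OF f(1)])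
  also have "\<dots> = (\<integral>v. F (f u \<bullet> f v) (f w \<bullet> f v) \<partial>sphere_uniform)"
    unfolding f(2,3) by (rule integral_distr[OF fM], rule measurable_sphere_uniform) measurable
  finally show ?thesis
    by (simp add: dot)
qed

lemma integrable_sphere_uniform:
  fixes f :: "'a::euclidean_space \<Rightarrow> real"
  assumes "continuous_on UNIV f"
  shows "integrable sphere_uniform f"
proof -
  interpret prob_space "sphere_uniform :: 'a measure"
    by (rule prob_space_sphere_uniform)
  have "compact (f ` sphere 0 1)"
    by (intro compact_continuous_image continuous_on_subset[OF assms]) auto
  then obtain B where B: "\<And>x. x \<in> sphere 0 1 \<Longrightarrow> norm (f x) \<le> B"
    by (meson bounded_iff compact_imp_bounded imageI)
  have "f \<in> borel_measurable sphere_uniform"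
    using assms by (intro measurable_sphere_uniform borel_measurable_continuous_onI)
  then show ?thesis
    using B by (intro integrable_const_bound[where B = B] AE_I2) (auto simp: space_sphere_uniform)
qed

section \<open>The Gegenbauer recurrence and the dimension formula\<close>

lemma gegenbauer_coeff_eq_0:
  "l < 2 * j \<Longrightarrow> gegenbauer_coeff d l j = 0"
proof (induction j)
  case (Suc j)
  show ?case
  proof (cases "l < 2 * j")
    case False
    then have "l = 2 * j \<or> l = Suc (2 * j)"
      using Suc.prems by arith
    then show ?thesis by auto
  qed (simp add: Suc.IH)
qed simp

lemma gegenbauer_coeff_Suc:
  assumes "d \<ge> 2"
  shows "2 * (real j + 1) * (real d - 1 + 2 * real j) * gegenbauer_coeff d n (Suc j)
    = - (real n - 2 * real j) * (real n - 2 * real j - 1) * gegenbauer_coeff d n j"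
proof -
  define A where "A = 2 * (real j + 1) * (real d - 1 + 2 * real j)"
  have "A \<noteq> 0"
    using assms by (simp add: A_def)
  then show ?thesis
    unfolding gegenbauer_coeff.simps(2) A_def[symmetric] by (simp add: field_simps)
qed

text \<open>
  Up to a sign and a factor that depends only on \<open>j\<close> and \<open>d\<close>, the coefficient with index \<open>j\<close> in degree \<open>n\<close> is
  \<open>n! / (n - 2 j)!\<close>. This lemma and the next one compare degree \<open>n\<close> with the degrees \<open>n + 1\<close> and \<open>n + 2\<close>; they are
  stated with the denominators multiplied out, and with the larger index on the larger degree, so
  that no division by the possibly vanishing factor \<open>n - 2 j\<close> occurs.
\<close>

lemma gegenbauer_coeff_Suc_Suc:
  assumes "d \<ge> 2"
  shows "2 * (real j + 1) * (real d - 1 + 2 * real j) * gegenbauer_coeff d (Suc n) (Suc j)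
    = - (real n + 1) * (real n - 2 * real j) * gegenbauer_coeff d n j"
proof (induction j)
  case 0
  show ?case using assms by (simp add: field_simps)
next
  case (Suc j)
  have nz: "real d - 1 + 2 * real j > 0" "real d - 1 + 2 * (real j + 1) > 0" "real j + 1 > 0" "real j + 2 > 0"
    using assms by auto
  define A where "A = 2 * (real j + 1) * (real d - 1 + 2 * real j)"
  define C where "C = gegenbauer_coeff d (Suc n) (Suc j)"
  define c where "c = gegenbauer_coeff d n j"
  have A: "A \<noteq> 0" using nz by (simp add: A_def)
  have IH: "A * C = - (real n + 1) * (real n - 2 * real j) * c"
    using Suc.IH by (simp add: A_def C_def c_def)
  have l: "2 * (real (Suc j) + 1) * (real d - 1 + 2 * real (Suc j)) * gegenbauer_coeff d (Suc n) (Suc (Suc j))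
      = - (real n - 1 - 2 * real j) * (real n - 2 - 2 * real j) * C"
    using nz unfolding gegenbauer_coeff.simps(2)[of d "Suc n" "Suc j"] C_def[symmetric]
    by (simp add: divide_simps) (simp add: algebra_simps)
  have r: "A * gegenbauer_coeff d n (Suc j) = - (real n - 2 * real j) * (real n - 2 * real j - 1) * c"
    using gegenbauer_coeff_Suc[OF assms, of j n] by (simp add: A_def c_def)
  have "A * (- (real n - 1 - 2 * real j) * (real n - 2 - 2 * real j) * C)
     = A * (- (real n + 1) * (real n - 2 * real (Suc j)) * gegenbauer_coeff d n (Suc j))"
  proof -
    have "A * (- (real n - 1 - 2 * real j) * (real n - 2 - 2 * real j) * C)
       = - (real n - 1 - 2 * real j) * (real n - 2 - 2 * real j) * (A * C)" by simp
    also have "\<dots> = - (real n + 1) * (real n - 2 * real (Suc j)) * (A * gegenbauer_coeff d n (Suc j))"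
      unfolding IH r by (simp add: algebra_simps)
    finally show ?thesis by simp
  qed
  then show ?case unfolding l using A by (simp del: gegenbauer_coeff.simps)
qed

lemma gegenbauer_coeff_add_2_Suc:
  assumes "d \<ge> 2"
  shows "2 * (real j + 1) * (real d - 1 + 2 * real j) * gegenbauer_coeff d (n + 2) (Suc j)
    = - (real n + 2) * (real n + 1) * gegenbauer_coeff d n j"
proof (induction j)
  case 0
  show ?case using assms by (simp add: field_simps)
next
  case (Suc j)
  have nz: "real d - 1 + 2 * real j > 0" "real d - 1 + 2 * (real j + 1) > 0" "real j + 1 > 0" "real j + 2 > 0"
    using assms by auto
  define A where "A = 2 * (real j + 1) * (real d - 1 + 2 * real j)"
  define C where "C = gegenbauer_coeff d (n + 2) (Suc j)"
  define c where "c = gegenbauer_coeff d n j"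
  have A: "A \<noteq> 0" using nz by (simp add: A_def)
  have IH: "A * C = - (real n + 2) * (real n + 1) * c"
    using Suc.IH by (simp add: A_def C_def c_def)
  have l: "2 * (real (Suc j) + 1) * (real d - 1 + 2 * real (Suc j)) * gegenbauer_coeff d (n + 2) (Suc (Suc j))
      = - (real n - 2 * real j) * (real n - 1 - 2 * real j) * C"
    using nz unfolding gegenbauer_coeff.simps(2)[of d "n + 2" "Suc j"] C_def[symmetric]
    by (simp add: divide_simps) (simp add: algebra_simps)
  have r: "A * gegenbauer_coeff d n (Suc j) = - (real n - 2 * real j) * (real n - 2 * real j - 1) * c"
    using gegenbauer_coeff_Suc[OF assms, of j n] by (simp add: A_def c_def)
  have "A * (- (real n - 2 * real j) * (real n - 1 - 2 * real j) * C)
     = A * (- (real n + 2) * (real n + 1) * gegenbauer_coeff d n (Suc j))"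
  proof -
    have "A * (- (real n - 2 * real j) * (real n - 1 - 2 * real j) * C)
       = - (real n - 2 * real j) * (real n - 1 - 2 * real j) * (A * C)" by simp
    also have "\<dots> = - (real n + 2) * (real n + 1) * (A * gegenbauer_coeff d n (Suc j))"
      unfolding IH r by (simp add: algebra_simps)
    finally show ?thesis by simp
  qed
  then show ?case unfolding l using A by (simp del: gegenbauer_coeff.simps)
qed

text \<open>
  The three-term recurrence on coefficients. By the preceding lemmas all the coefficients involved are
  multiples of \<open>gegenbauer_coeff d n j\<close>, and a polynomial identity in \<open>n\<close>, \<open>j\<close> and \<open>d\<close> remains.
\<close>

lemma gegenbauer_coeff_recurrence:
  assumes "d \<ge> 2"
  shows "(real n + real d - 1) * gegenbauer_coeff d (n + 2) (Suc j)
    = (2 * real n + real d) * gegenbauer_coeff d (Suc n) (Suc j)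
      - (real n + 1) * (gegenbauer_coeff d n (Suc j) + gegenbauer_coeff d n j)"
proof -
  define A where "A = 2 * (real j + 1) * (real d - 1 + 2 * real j)"
  define c where "c = gegenbauer_coeff d n j"
  have A: "A \<noteq> 0" using assms by (simp add: A_def)
  have 1: "A * gegenbauer_coeff d (n + 2) (Suc j) = - (real n + 2) * (real n + 1) * c"
    using gegenbauer_coeff_add_2_Suc[OF assms, of j n] by (simp add: A_def c_def)
  have 2: "A * gegenbauer_coeff d (Suc n) (Suc j) = - (real n + 1) * (real n - 2 * real j) * c"
    using gegenbauer_coeff_Suc_Suc[OF assms, of j n] by (simp add: A_def c_def)
  have 3: "A * gegenbauer_coeff d n (Suc j) = - (real n - 2 * real j) * (real n - 2 * real j - 1) * c"
    using gegenbauer_coeff_Suc[OF assms, of j n] by (simp add: A_def c_def)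
  have "A * ((real n + real d - 1) * gegenbauer_coeff d (n + 2) (Suc j))
      = (real n + real d - 1) * (A * gegenbauer_coeff d (n + 2) (Suc j))" by simp
  also have "\<dots> = (2 * real n + real d) * (A * gegenbauer_coeff d (Suc n) (Suc j))
      - (real n + 1) * (A * gegenbauer_coeff d n (Suc j) + A * c)"
    unfolding 1 2 3 by (simp add: A_def algebra_simps)
  also have "\<dots> = A * ((2 * real n + real d) * gegenbauer_coeff d (Suc n) (Suc j)
      - (real n + 1) * (gegenbauer_coeff d n (Suc j) + gegenbauer_coeff d n j))"
    by (simp add: algebra_simps c_def del: gegenbauer_coeff.simps)
  finally show ?thesis using A by (simp del: gegenbauer_coeff.simps)
qed

lemma gegenbauer_eq_sum:
  assumes "l div 2 \<le> N"
  shows "gegenbauer d l t = (\<Sum>j\<le>N. gegenbauer_coeff d l j * t ^ (l - 2 * j) * (1 - t\<^sup>2) ^ j)"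
  unfolding gegenbauer_def
  by (rule sum.mono_neutral_left) (use assms in \<open>auto intro!: gegenbauer_coeff_eq_0\<close>)

text \<open>
  With \<open>s = 1 - t\<^sup>2\<close>, the polynomial of degree \<open>n + 2\<close> and \<open>t\<close> times the one of degree \<open>n + 1\<close> are
  combinations of the monomials \<open>t\<^bsup>n+2-2j\<^esup> s\<^sup>j\<close>. The polynomial of degree \<open>n\<close> is brought
  to the same form by multiplying with \<open>1 = t\<^sup>2 + s\<close>, which is where the sum of two adjacent coefficients comes from.
\<close>

lemma gegenbauer_recurrence:
  assumes "d \<ge> 2"
  shows "(real n + real d - 1) * gegenbauer d (n + 2) t
    = (2 * real n + real d) * (t * gegenbauer d (Suc n) t) - (real n + 1) * gegenbauer d n t"
proof -
  define s where "s = 1 - t\<^sup>2"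
  define T where "T j = t ^ (n + 2 - 2 * j) * s ^ j" for j
  define c where "c = gegenbauer_coeff d"
  have c0: "c l 0 = 1" for l by (simp add: c_def)
  have z: "c l j = 0" if "l < 2 * j" for l j
    using that by (simp add: c_def gegenbauer_coeff_eq_0)
  have gs: "gegenbauer d l t = (\<Sum>j\<le>N. c l j * t ^ (l - 2 * j) * s ^ j)" if "l div 2 \<le> N" for l N
    using gegenbauer_eq_sum[OF that] by (simp add: c_def s_def)
  have G2: "gegenbauer d (n + 2) t = T 0 + (\<Sum>j\<le>n. c (n + 2) (Suc j) * T (Suc j))"
    using gs[of "n + 2" "Suc n"]
    by (simp add: sum.atMost_Suc_shift T_def c0 mult.assoc del: sum.atMost_Suc)
  have "t * (c (Suc n) j * t ^ (Suc n - 2 * j) * s ^ j) = c (Suc n) j * T j" for j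
  proof (cases "2 * j \<le> Suc n")
    case True
    then have "n + 2 - 2 * j = Suc (Suc n - 2 * j)" by simp
    then show ?thesis by (simp add: T_def)
  qed (simp add: z)
  then have "t * gegenbauer d (Suc n) t = (\<Sum>j\<le>Suc n. c (Suc n) j * T j)"
    by (subst gs[of "Suc n" "Suc n"]) (auto simp only: sum_distrib_left)
  also have "\<dots> = T 0 + (\<Sum>j\<le>n. c (Suc n) (Suc j) * T (Suc j))"
    by (simp add: sum.atMost_Suc_shift c0 del: sum.atMost_Suc)
  finally have G1: "t * gegenbauer d (Suc n) t = \<dots>" .
  have low: "c n j * t ^ (n - 2 * j) * s ^ j * t\<^sup>2 = c n j * T j" for j
  proof (cases "2 * j \<le> n")
    case True
    then have "n + 2 - 2 * j = n - 2 * j + 2" by simp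
    then show ?thesis by (simp add: T_def power_add power2_eq_square)
  qed (simp add: z)
  have high: "c n j * t ^ (n - 2 * j) * s ^ j * s = c n j * T (Suc j)" for j
    by (simp add: T_def)
  (* 1 = t^2 + s lifts degree n to degree n + 2 *)
  have "gegenbauer d n t = gegenbauer d n t * t\<^sup>2 + gegenbauer d n t * s"
    by (simp add: s_def algebra_simps)
  also have "gegenbauer d n t * t\<^sup>2 = (\<Sum>j\<le>Suc n. c n j * T j)"
    by (subst gs[of n "Suc n"]) (auto simp only: sum_distrib_right low)
  also have "\<dots> = T 0 + (\<Sum>j\<le>n. c n (Suc j) * T (Suc j))"
    by (simp add: sum.atMost_Suc_shift c0 del: sum.atMost_Suc)
  also have "gegenbauer d n t * s = (\<Sum>j\<le>n. c n j * T (Suc j))"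
    by (subst gs[of n n]) (auto simp only: sum_distrib_right high)
  finally have G0: "gegenbauer d n t = T 0 + (\<Sum>j\<le>n. (c n (Suc j) + c n j) * T (Suc j))"
    by (simp add: sum.distrib algebra_simps)
  have "(real n + real d - 1) * (c (n + 2) (Suc j) * T (Suc j))
      = (2 * real n + real d) * (c (Suc n) (Suc j) * T (Suc j))
        - (real n + 1) * ((c n (Suc j) + c n j) * T (Suc j))" for j
    using arg_cong[OF gegenbauer_coeff_recurrence[OF assms, of n j], of "\<lambda>x. x * T (Suc j)"]
    by (simp add: c_def algebra_simps del: gegenbauer_coeff.simps)
  then have "(real n + real d - 1) * (\<Sum>j\<le>n. c (n + 2) (Suc j) * T (Suc j))
      = (2 * real n + real d) * (\<Sum>j\<le>n. c (Suc n) (Suc j) * T (Suc j))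
        - (real n + 1) * (\<Sum>j\<le>n. (c n (Suc j) + c n j) * T (Suc j))"
    by (simp add: sum_distrib_left sum_subtractf[symmetric])
  then show ?thesis
    unfolding G2 G1 G0 by (simp add: algebra_simps)
qed

text \<open>
  The recurrence is taken as the definition because degrees and inner products are computed from it
  by induction. Degree \<open>1\<close> is a separate equation since the recurrence for it would divide by
  \<open>d - 2\<close>, which may be \<open>0\<close>.
\<close>

fun gegenbauer_poly :: "nat \<Rightarrow> nat \<Rightarrow> real poly" where
  "gegenbauer_poly d 0 = 1"
| "gegenbauer_poly d (Suc 0) = [:0, 1:]"
| "gegenbauer_poly d (Suc (Suc n)) =
     smult (1 / (real n + real d - 1))
       (smult (2 * real n + real d) ([:0, 1:] * gegenbauer_poly d (Suc n))
        - smult (real n + 1) (gegenbauer_poly d n))"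

lemma poly_gegenbauer_poly:
  assumes "d \<ge> 2"
  shows "poly (gegenbauer_poly d l) t = gegenbauer d l t"
  using assms
proof (induction d l rule: gegenbauer_poly.induct)
  case (3 d n)
  have "real n + real d - 1 > 0"
    using 3(3) by simp
  moreover have "(real n + real d - 1) * poly (gegenbauer_poly d (Suc (Suc n))) t
      = (real n + real d - 1) * gegenbauer d (n + 2) t"
    unfolding gegenbauer_recurrence[OF 3(3), of n t] using 3 by simp
  ultimately show ?case
    by (simp del: gegenbauer_poly.simps)
qed (simp_all add: gegenbauer_def)

lemma X_times_gegenbauer_poly:
  assumes "d \<ge> 2"
  shows "smult (2 * real n + real d) ([:0, 1:] * gegenbauer_poly d (Suc n))
    = smult (real n + real d - 1) (gegenbauer_poly d (Suc (Suc n))) + smult (real n + 1) (gegenbauer_poly d n)"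
  using assms by simp

lemma gegenbauer_1: "gegenbauer d l 1 = 1"
  by (simp add: gegenbauer_def power_0_left if_distrib[of "\<lambda>x. _ * x"] sum.delta' cong: if_cong)

lemma degree_gegenbauer_poly:
  assumes "d \<ge> 2"
  shows "degree (gegenbauer_poly d l) = l"
proof -
  have "degree (gegenbauer_poly d l) \<le> l \<and> coeff (gegenbauer_poly d l) l > 0"
    using assms
  proof (induction d l rule: gegenbauer_poly.induct)
    case (3 d n)
    have pos: "real n + real d - 1 > 0" "2 * real n + real d > 0"
      using 3(3) by auto
    have IH: "degree (gegenbauer_poly d (Suc n)) \<le> Suc n" "coeff (gegenbauer_poly d (Suc n)) (Suc n) > 0"
        "degree (gegenbauer_poly d n) \<le> n"
      using 3 by auto
    have "coeff (gegenbauer_poly d n) (Suc (Suc n)) = 0"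
      using IH(3) by (intro coeff_eq_0) simp
    moreover have "degree ([:0, 1:] * gegenbauer_poly d (Suc n)) \<le> Suc (Suc n)"
      using degree_mult_le[of "[:0, 1:]" "gegenbauer_poly d (Suc n)"] IH(1) by simp
    ultimately show ?case
      using IH pos by (auto intro!: order_trans[OF degree_smult_le] degree_diff_le)
  qed auto
  then show ?thesis
    by (metis le_antisym le_degree less_irrefl)
qed

lemma harmonic_dim_Suc:
  assumes "d \<ge> 2"
  shows "harmonic_dim (Suc n) d
    = (2 * real n + real d) * fact (n + d - 2) / (fact (Suc n) * fact (d - 2))"
proof -
  obtain e where d: "d = e + 2"
    using assms by (metis add.commute le_Suc_ex)
  show ?thesis
  proof (cases n)
    case 0
    then show ?thesis by (simp add: harmonic_dim_def d)
  next
    case (Suc k)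
    have 1: "real ((e + k + 3) choose (k + 2)) = fact (e + k + 3) / (fact (k + 2) * fact (e + 1))"
      by (subst binomial_fact) auto
    have 2: "real ((e + k + 1) choose k) = fact (e + k + 1) / (fact k * fact (e + 1))"
      by (subst binomial_fact) auto
    have "harmonic_dim (Suc n) d = real ((e + k + 3) choose (k + 2)) - real ((e + k + 1) choose k)"
      by (simp add: harmonic_dim_def d Suc add_ac numeral_3_eq_3)
    also have "\<dots> = ((real e + real k + 3) * (real e + real k + 2) - (real k + 2) * (real k + 1))
        * fact (e + k + 1) / (fact (k + 2) * ((real e + 1) * fact e))"
    proof -
      have a: "fact (e + k + 3) = (real e + real k + 3) * ((real e + real k + 2) * fact (e + k + 1))"
        by (simp add: numeral_3_eq_3 algebra_simps)
      have b: "fact (k + 2) = (real k + 2) * ((real k + 1) * fact k)"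
        by (simp add: algebra_simps)
      have c: "fact (e + 1) = (real e + 1) * fact e"
        by simp
      show ?thesis unfolding 1 2 a b c
        by (simp add: divide_simps del: fact_Suc) (simp add: algebra_simps del: fact_Suc)
    qed
    also have "(real e + real k + 3) * (real e + real k + 2) - (real k + 2) * (real k + 1)
        = (real e + 1) * (real e + 2 * real k + 4)"
      by (simp add: algebra_simps)
    finally show ?thesis by (simp add: d Suc add_ac del: fact_Suc)
  qed
qed

lemma harmonic_dim_pos:
  assumes "d \<ge> 2"
  shows "harmonic_dim l d > 0"
  using assms by (cases l) (simp add: harmonic_dim_def, simp add: harmonic_dim_Suc del: fact_Suc)

text \<open>
  The quotient of consecutive dimensions is the inverse of the quotient of consecutive square norms of
  the Gegenbauer polynomials.
\<close>

lemma harmonic_dim_ratio: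
  assumes "d \<ge> 2"
  shows "(real n + 2) * (2 * real n + real d) * harmonic_dim (Suc (Suc n)) d
    = (2 * real n + real d + 2) * (real n + real d - 1) * harmonic_dim (Suc n) d"
proof -
  obtain e where d: "d = e + 2"
    using assms by (metis add.commute le_Suc_ex)
  define F :: real where "F = fact (n + e) / (fact (Suc n) * fact e)"
  have 1: "harmonic_dim (Suc n) d = (2 * real n + real d) * F"
    unfolding harmonic_dim_Suc[OF assms] F_def by (simp add: d)
  have "harmonic_dim (Suc (Suc n)) d = (2 * real n + real d + 2) * (real n + real e + 1) * F / (real n + 2)"
    unfolding harmonic_dim_Suc[OF assms] F_def
    by (simp add: d divide_simps) (simp add: algebra_simps)
  then show ?thesis
    unfolding 1 by (simp add: d)
qed

section \<open>Moments of a linear functional on the sphere\<close>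

definition zonal_mean :: "'a::euclidean_space \<Rightarrow> real poly \<Rightarrow> real" where
  "zonal_mean u p = (\<integral>v. poly p (u \<bullet> v) \<partial>sphere_uniform)"

lemma integrable_zonal: "integrable sphere_uniform (\<lambda>v. poly p (u \<bullet> v))"
  by (intro integrable_sphere_uniform continuous_intros)

lemma zonal_mean_add: "zonal_mean u (p + q) = zonal_mean u p + zonal_mean u q"
  by (simp add: zonal_mean_def integrable_zonal)

lemma zonal_mean_smult: "zonal_mean u (smult c p) = c * zonal_mean u p"
  by (simp add: zonal_mean_def)

lemma zonal_mean_0: "zonal_mean u 0 = 0"
  by (simp add: zonal_mean_def)

lemma zonal_mean_sum: "zonal_mean u (\<Sum>i\<in>A. p i) = (\<Sum>i\<in>A. zonal_mean u (p i))"
  by (induction A rule: infinite_finite_induct) (simp_all add: zonal_mean_add zonal_mean_0)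

lemma zonal_mean_1: "zonal_mean (u::'a::euclidean_space) 1 = 1"
proof -
  interpret prob_space "sphere_uniform :: 'a measure"
    by (rule prob_space_sphere_uniform)
  show ?thesis
    by (simp add: zonal_mean_def prob_space)
qed

lemma zonal_mean_cong:
  fixes u u' :: "'a::euclidean_space"
  assumes "norm u = norm u'"
  shows "zonal_mean u p = zonal_mean u' p"
proof -
  have [measurable]: "poly p \<in> borel_measurable borel"
    by (intro borel_measurable_continuous_onI continuous_intros)
  show ?thesis
    unfolding zonal_mean_def
    by (rule sphere_integral_pair_cong[of u u' u u' "\<lambda>x y. poly p x"])
      (use assms in \<open>auto simp: power2_norm_eq_inner[symmetric]\<close>)
qed

lemma coeff_one_plus_X_squared_power:
  "coeff ([:1, 0, 1::real:] ^ n) 0 = 1 \<and> coeff ([:1, 0, 1::real:] ^ n) 2 = real n"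
  by (induction n) (auto simp: coeff_pCons numeral_2_eq_2)

text \<open>
  For every real \<open>s\<close>, the vector \<open>e + s b\<close> has the length of \<open>sqrt (1 + s\<^sup>2) e\<close>, so the two have the same
  moments. Both moments of order \<open>2 a + 2\<close> are polynomials in \<open>s\<close>, and the identity is the comparison of
  their coefficients at \<open>s\<^sup>2\<close>.
\<close>

lemma integral_orthonormal_pair:
  fixes e b :: "'a::euclidean_space"
  assumes e: "norm e = 1" and b: "norm b = 1" and eb: "e \<bullet> b = 0"
  shows "(2 * real a + 1) * (\<integral>v. (e \<bullet> v) ^ (2 * a) * (b \<bullet> v)\<^sup>2 \<partial>sphere_uniform)
    = (\<integral>v. (e \<bullet> v) ^ (2 * a + 2) \<partial>sphere_uniform)"
proof -
  define n where "n = 2 * a + 2"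
  define M where "M = (\<integral>v. (e \<bullet> v) ^ n \<partial>sphere_uniform)"
  define I where "I k = (\<integral>v. (b \<bullet> v) ^ k * (e \<bullet> v) ^ (n - k) \<partial>sphere_uniform)" for k
  define p where "p = (\<Sum>k\<le>n. monom (real (n choose k) * I k) k)"
  define q where "q = smult M ([:1, 0, 1:] ^ (a + 1))"
  have "poly p s = poly q s" for s
  proof -
    have ee: "e \<bullet> e = 1" "b \<bullet> b = 1" "b \<bullet> e = 0"
      using e b eb by (simp_all add: norm_eq_1 inner_commute)
    have nrm: "norm (e + s *\<^sub>R b) = norm (sqrt (1 + s\<^sup>2) *\<^sub>R e)"
      by (simp add: norm_eq_sqrt_inner inner_add_left inner_add_right ee eb power2_eq_square add_nonneg_nonneg)
    have "poly p s = (\<Sum>k\<le>n. \<integral>v. real (n choose k) * (s * (b \<bullet> v)) ^ k * (e \<bullet> v) ^ (n - k) \<partial>sphere_uniform)"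
      unfolding p_def poly_sum poly_monom I_def
      by (intro sum.cong refl, subst mult.commute, subst Bochner_Integration.integral_mult_right_zero[symmetric],
          subst Bochner_Integration.integral_mult_right_zero[symmetric])
        (simp add: power_mult_distrib mult_ac)
    also have "\<dots> = (\<integral>v. (s * (b \<bullet> v) + e \<bullet> v) ^ n \<partial>sphere_uniform)"
      unfolding binomial_ring
      by (intro Bochner_Integration.integral_sum[symmetric] integrable_sphere_uniform continuous_intros)
    also have "\<dots> = zonal_mean (e + s *\<^sub>R b) (monom 1 n)"
      by (simp add: zonal_mean_def poly_monom inner_add_left add.commute)
    also have "\<dots> = zonal_mean (sqrt (1 + s\<^sup>2) *\<^sub>R e) (monom 1 n)"
      by (rule zonal_mean_cong[OF nrm])
    also have "\<dots> = (sqrt (1 + s\<^sup>2)) ^ n * M"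
      by (simp add: zonal_mean_def poly_monom power_mult_distrib M_def)
    also have "(sqrt (1 + s\<^sup>2)) ^ n = (1 + s\<^sup>2) ^ (a + 1)"
    proof -
      have "sqrt (1 + s\<^sup>2) ^ (2 * (a + 1)) = ((sqrt (1 + s\<^sup>2))\<^sup>2) ^ (a + 1)"
        by (rule power_mult)
      then show ?thesis
        by (simp add: n_def add_nonneg_nonneg)
    qed
    also have "(1 + s\<^sup>2) ^ (a + 1) * M = poly q s"
    proof -
      have "poly [:1, 0, 1:] s = 1 + s\<^sup>2"
        by (simp add: power2_eq_square)
      then show ?thesis
        unfolding q_def poly_smult poly_power by (simp only: mult.commute)
    qed
    finally show ?thesis .
  qed
  then have "p = q"
    by (simp add: poly_eq_poly_eq_iff[symmetric] fun_eq_iff)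
  then have "coeff p 2 = coeff q 2"
    by simp
  moreover have "coeff p 2 = real (n choose 2) * I 2"
  proof -
    have "2 \<le> n"
      by (simp add: n_def)
    then show ?thesis
      by (simp add: p_def coeff_sum)
  qed
  moreover have "coeff q 2 = M * real (a + 1)"
    unfolding q_def coeff_smult using coeff_one_plus_X_squared_power[of "a + 1"] by simp
  moreover have "n choose 2 = (a + 1) * (2 * a + 1)"
    by (simp add: choose_two n_def)
  ultimately have "real (a + 1) * ((2 * real a + 1) * I 2) = real (a + 1) * M"
    by (simp add: algebra_simps)
  then have "(2 * real a + 1) * I 2 = M"
    by (subst (asm) mult_left_cancel) auto
  then show ?thesis
    by (simp add: I_def M_def n_def mult.commute)
qed

definition zonal_moment :: "'a::euclidean_space \<Rightarrow> nat \<Rightarrow> nat \<Rightarrow> real" where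
  "zonal_moment u a b = (\<integral>v. (u \<bullet> v) ^ (2 * a) * (1 - (u \<bullet> v)\<^sup>2) ^ b \<partial>sphere_uniform)"

lemma zonal_moment_split:
  "zonal_moment u a (Suc b) = zonal_moment u a b - zonal_moment u (Suc a) b"
  unfolding zonal_moment_def
  by (subst Bochner_Integration.integral_diff[symmetric])
    (auto intro!: integrable_sphere_uniform continuous_intros simp: algebra_simps power2_eq_square)

text \<open>
  On the sphere \<open>1 - (e \<bullet> v)\<^sup>2\<close> is the sum of \<open>(b \<bullet> v)\<^sup>2\<close> over the \<open>d - 1\<close> other vectors \<open>b\<close> of an
  orthonormal basis, and each of them contributes equally.
\<close>

lemma zonal_moment_0_1:
  fixes u :: "'a::euclidean_space"
  assumes u: "norm u = 1"
  shows "(2 * real a + 1) * zonal_moment u a (Suc 0) = (real DIM('a) - 1) * zonal_moment u (Suc a) 0"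
proof -
  obtain e :: 'a where e: "e \<in> Basis"
    using nonempty_Basis by blast
  have tr: "zonal_moment u k l = zonal_moment e k l" for k l
    using zonal_mean_cong[of u e "monom 1 (2 * k) * [:1, 0, -1:] ^ l"] u e
    by (simp add: zonal_mean_def zonal_moment_def poly_monom power2_eq_square)
  have "zonal_moment e a (Suc 0)
      = (\<integral>v. (\<Sum>b\<in>Basis - {e}. (e \<bullet> v) ^ (2 * a) * (b \<bullet> v)\<^sup>2) \<partial>sphere_uniform)"
    unfolding zonal_moment_def
  proof (rule Bochner_Integration.integral_cong[OF refl])
    fix v :: 'a assume "v \<in> space sphere_uniform"
    then have "v \<bullet> v = 1"
      by (simp add: space_sphere_uniform norm_eq_1)
    then have "1 = (\<Sum>b\<in>Basis. (b \<bullet> v)\<^sup>2)"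
      by (simp add: euclidean_inner[of v v] power2_eq_square inner_commute)
    also have "\<dots> = (e \<bullet> v)\<^sup>2 + (\<Sum>b\<in>Basis - {e}. (b \<bullet> v)\<^sup>2)"
      using e by (simp add: sum.remove)
    finally show "(e \<bullet> v) ^ (2 * a) * (1 - (e \<bullet> v)\<^sup>2) ^ Suc 0
        = (\<Sum>b\<in>Basis - {e}. (e \<bullet> v) ^ (2 * a) * (b \<bullet> v)\<^sup>2)"
      by (simp add: sum_distrib_left[symmetric])
  qed
  also have "\<dots> = (\<Sum>b\<in>Basis - {e}. \<integral>v. (e \<bullet> v) ^ (2 * a) * (b \<bullet> v)\<^sup>2 \<partial>sphere_uniform)"
    by (intro Bochner_Integration.integral_sum integrable_sphere_uniform continuous_intros)
  finally have "(2 * real a + 1) * zonal_moment e a (Suc 0)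
      = (\<Sum>b\<in>Basis - {e}. (2 * real a + 1) * (\<integral>v. (e \<bullet> v) ^ (2 * a) * (b \<bullet> v)\<^sup>2 \<partial>sphere_uniform))"
    by (simp add: sum_distrib_left)
  also have "\<dots> = (\<Sum>b\<in>Basis - {e}. zonal_moment e (Suc a) 0)"
    using e by (intro sum.cong refl, subst integral_orthonormal_pair)
      (auto simp: zonal_moment_def inner_Basis)
  also have "\<dots> = (real DIM('a) - 1) * zonal_moment e (Suc a) 0"
    using e by (simp add: card_Diff_singleton of_nat_diff DIM_positive Suc_leI)
  finally show ?thesis
    by (simp add: tr)
qed

text \<open>
  The case \<open>b = 0\<close> propagates to all \<open>b\<close> by writing \<open>1\<close> as \<open>(u \<bullet> v)\<^sup>2 + (1 - (u \<bullet> v)\<^sup>2)\<close>.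
\<close>

lemma zonal_moment_Suc:
  fixes u :: "'a::euclidean_space"
  assumes u: "norm u = 1"
  shows "(2 * real a + 1) * zonal_moment u a (Suc b)
    = (real DIM('a) - 1 + 2 * real b) * zonal_moment u (Suc a) b"
proof (induction b arbitrary: a)
  case 0
  show ?case using zonal_moment_0_1[OF u] by simp
next
  case (Suc b)
  have "(2 * real a + 1) * zonal_moment u a (Suc (Suc b))
      = (2 * real a + 1) * zonal_moment u a (Suc b) - (2 * real a + 1) * zonal_moment u (Suc a) (Suc b)"
    by (subst zonal_moment_split) (simp add: right_diff_distrib)
  also have "(2 * real a + 1) * zonal_moment u a (Suc b)
      = (real DIM('a) - 1 + 2 * real b) * (zonal_moment u (Suc a) (Suc b) + zonal_moment u (Suc (Suc a)) b)"
    by (simp add: Suc.IH zonal_moment_split[of u "Suc a" b])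
  also have "\<dots> = (real DIM('a) - 1 + 2 * real b) * zonal_moment u (Suc a) (Suc b)
      + (2 * real (Suc a) + 1) * zonal_moment u (Suc a) (Suc b)"
    using Suc.IH[of "Suc a"] by (simp add: distrib_left)
  finally show ?case
    by (simp add: algebra_simps)
qed

text \<open>
  Odd degrees vanish by the symmetry \<open>u \<mapsto> -u\<close>. In even degree \<open>2 m\<close> the recursions of the coefficients
  and of the moments combine so that the \<open>j\<close>-th summand is \<open>(-1)\<^sup>j (m choose j)\<close> times a constant, and the
  alternating sum of binomial coefficients is \<open>0\<close>.
\<close>

lemma integral_gegenbauer_eq_0:
  fixes u :: "'a::euclidean_space"
  assumes u: "norm u = 1" and d: "DIM('a) \<ge> 2" and l: "l > 0"
  shows "(\<integral>v. gegenbauer DIM('a) l (u \<bullet> v) \<partial>sphere_uniform) = 0"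
proof (cases "even l")
  case True
  then obtain m where m: "l = 2 * m" by blast
  have "gegenbauer_coeff DIM('a) l j * zonal_moment u (m - j) j
      = (-1) ^ j * real (m choose j) * zonal_moment u m 0" if "j \<le> m" for j
    using that
  proof (induction j)
    case (Suc j)
    define a where "a = m - Suc j"
    have mj: "m - j = Suc a" "real m = real a + real j + 1"
      using Suc.prems by (auto simp: a_def)
    define D where "D = real DIM('a) - 1 + 2 * real j"
    have D: "D > 0"
      using d by (simp add: D_def)
    have c: "gegenbauer_coeff DIM('a) l (Suc j) = - ((real a + 1) * (2 * real a + 1) / ((real j + 1) * D)) * gegenbauer_coeff DIM('a) l j"
    proof -
      have 1: "real l - 2 * real j = 2 * (real a + 1)"
        by (simp add: m mj)
      have 2: "2 * (real a + 1) - 1 = 2 * real a + 1"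
        by simp
      show ?thesis
        unfolding gegenbauer_coeff.simps D_def[symmetric] 1 2 mult.assoc[of 2]
          mult_divide_mult_cancel_left[of "2::real", OF zero_neq_numeral[symmetric]] ..
    qed
    have "gegenbauer_coeff DIM('a) l (Suc j) * zonal_moment u a (Suc j)
      = - ((real a + 1) / ((real j + 1) * D)) * gegenbauer_coeff DIM('a) l j * ((2 * real a + 1) * zonal_moment u a (Suc j))"
      unfolding c by simp
    also have "\<dots> = - ((real a + 1) / (real j + 1)) * (gegenbauer_coeff DIM('a) l j * zonal_moment u (m - j) j)"
      using D by (simp add: zonal_moment_Suc[OF u] D_def[symmetric] mj)
    also have "\<dots> = - ((real a + 1) / (real j + 1)) * ((-1) ^ j * real (m choose j) * zonal_moment u m 0)"
      using Suc by simp
    also have "\<dots> = (-1) ^ Suc j * ((real a + 1) * real (m choose j) / (real j + 1)) * zonal_moment u m 0"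
      by simp
    also have "(real a + 1) * real (m choose j) / (real j + 1) = real (m choose Suc j)"
    proof -
      have "Suc j * (m choose Suc j) = Suc a * (m choose j)"
        unfolding mj(1)[symmetric] binomial_absorption binomial_absorb_comp ..
      then have "real (Suc j) * real (m choose Suc j) = real (Suc a) * real (m choose j)"
        by (metis of_nat_mult)
      then show ?thesis
        by (simp add: field_simps)
    qed
    finally show ?case
      by (simp add: a_def)
  qed simp
  then have "(\<Sum>j\<le>m. gegenbauer_coeff DIM('a) l j * zonal_moment u (m - j) j)
      = (\<Sum>j\<le>m. (-1) ^ j * real (m choose j)) * zonal_moment u m 0"
    by (simp add: sum_distrib_right)
  also have "\<dots> = 0"
    using choose_alternating_sum[of m, where 'a = real] l m by simp
  finally have "(\<Sum>j\<le>m. gegenbauer_coeff DIM('a) l j * zonal_moment u (m - j) j) = 0" .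
  moreover have "(\<integral>v. gegenbauer DIM('a) l (u \<bullet> v) \<partial>sphere_uniform)
     = (\<Sum>j\<le>m. \<integral>v. gegenbauer_coeff DIM('a) l j * ((u \<bullet> v) ^ (2 * (m - j)) * (1 - (u \<bullet> v)\<^sup>2) ^ j) \<partial>sphere_uniform)"
    unfolding gegenbauer_def m
    by (subst Bochner_Integration.integral_sum)
      (auto intro!: integrable_sphere_uniform continuous_intros simp: mult.assoc diff_mult_distrib2 atLeast0AtMost)
  ultimately show ?thesis
    by (simp add: zonal_moment_def)
next
  case False
  have "gegenbauer DIM('a) l (- t) = - gegenbauer DIM('a) l t" for t
    unfolding gegenbauer_def using False
    by (subst sum_negf[symmetric]) (auto intro!: sum.cong simp: power_minus_odd)
  moreover have "zonal_mean u (gegenbauer_poly DIM('a) l) = zonal_mean (- u) (gegenbauer_poly DIM('a) l)"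
    by (rule zonal_mean_cong) simp
  ultimately show ?thesis
    by (simp add: zonal_mean_def poly_gegenbauer_poly[OF d])
qed

section \<open>Orthogonality of the Gegenbauer polynomials\<close>

lemma zonal_mean_gegenbauer_eq_0:
  fixes u :: "'a::euclidean_space"
  assumes "norm u = 1" "DIM('a) \<ge> 2" "l > 0"
  shows "zonal_mean u (gegenbauer_poly DIM('a) l) = 0"
  unfolding zonal_mean_def poly_gegenbauer_poly[OF assms(2)] by (rule integral_gegenbauer_eq_0[OF assms])

lemma zonal_mean_X_times_gegenbauer:
  fixes u :: "'a::euclidean_space"
  assumes d: "DIM('a) \<ge> 2"
  shows "(2 * real n + real DIM('a)) * zonal_mean u (p * [:0, 1:] * gegenbauer_poly DIM('a) (Suc n))
    = (real n + real DIM('a) - 1) * zonal_mean u (p * gegenbauer_poly DIM('a) (Suc (Suc n)))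
      + (real n + 1) * zonal_mean u (p * gegenbauer_poly DIM('a) n)"
proof -
  have "zonal_mean u (p * smult (2 * real n + real DIM('a)) ([:0, 1:] * gegenbauer_poly DIM('a) (Suc n)))
    = zonal_mean u (p * (smult (real n + real DIM('a) - 1) (gegenbauer_poly DIM('a) (Suc (Suc n)))
      + smult (real n + 1) (gegenbauer_poly DIM('a) n)))"
    by (simp only: X_times_gegenbauer_poly[OF d])
  then show ?thesis
    by (simp only: mult_smult_right distrib_left zonal_mean_add zonal_mean_smult mult.assoc)
qed

text \<open>
  By the recurrence, each factor \<open>t\<close> changes the index of the Gegenbauer polynomial by at most one, so
  fewer than \<open>n\<close> factors cannot bring it down to \<open>0\<close>, the only index with a nonzero mean.
\<close>

lemma zonal_mean_power_times_gegenbauer: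
  fixes u :: "'a::euclidean_space"
  assumes u: "norm u = 1" and d: "DIM('a) \<ge> 2" and "k < n"
  shows "zonal_mean u ([:0, 1:] ^ k * gegenbauer_poly DIM('a) n) = 0"
  using \<open>k < n\<close>
proof (induction k arbitrary: n)
  case 0
  then show ?case
    by (simp add: zonal_mean_gegenbauer_eq_0[OF u d])
next
  case (Suc k)
  then obtain m where m: "n = Suc m" "k < m"
    by (cases n) auto
  have "(2 * real m + real DIM('a)) * zonal_mean u ([:0, 1:] ^ k * [:0, 1:] * gegenbauer_poly DIM('a) (Suc m)) = 0"
    unfolding zonal_mean_X_times_gegenbauer[OF d] using m Suc.IH[of m] Suc.IH[of "Suc (Suc m)"] by simp
  then show ?case
    using d by (simp add: m mult_ac del: mult_pCons_left mult_pCons_right)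
qed

lemma zonal_mean_times_gegenbauer_eq_0:
  fixes u :: "'a::euclidean_space"
  assumes u: "norm u = 1" and d: "DIM('a) \<ge> 2" and p: "degree p < n"
  shows "zonal_mean u (p * gegenbauer_poly DIM('a) n) = 0"
proof -
  have "p * gegenbauer_poly DIM('a) n
      = (\<Sum>i\<le>degree p. smult (coeff p i) ([:0, 1:] ^ i * gegenbauer_poly DIM('a) n))"
    by (subst poly_as_sum_of_monoms[symmetric]) (simp add: monom_altdef sum_distrib_right)
  then show ?thesis
    using p by (simp add: zonal_mean_sum zonal_mean_smult zonal_mean_power_times_gegenbauer[OF u d])
qed

lemma zonal_mean_gegenbauer_orthogonal:
  fixes u :: "'a::euclidean_space"
  assumes u: "norm u = 1" and d: "DIM('a) \<ge> 2" and "m \<noteq> n"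
  shows "zonal_mean u (gegenbauer_poly DIM('a) m * gegenbauer_poly DIM('a) n) = 0"
proof (cases "m < n")
  case True
  then show ?thesis
    by (intro zonal_mean_times_gegenbauer_eq_0[OF u d]) (simp add: degree_gegenbauer_poly[OF d])
next
  case False
  then show ?thesis
    using \<open>m \<noteq> n\<close>
    by (subst mult.commute, intro zonal_mean_times_gegenbauer_eq_0[OF u d]) (simp add: degree_gegenbauer_poly[OF d])
qed

text \<open>
  The mean of \<open>t P\<^bsub>n+1\<^esub> P\<^bsub>n+2\<^esub>\<close> can be evaluated by applying the recurrence to either factor. With
  orthogonality this yields the quotient of consecutive square norms, which matches
  \<open>harmonic_dim_ratio\<close>. Degree \<open>1\<close> has to be computed by hand.
\<close>

lemma zonal_mean_gegenbauer_square:
  fixes u :: "'a::euclidean_space"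
  assumes u: "norm u = 1" and d: "DIM('a) \<ge> 2"
  shows "harmonic_dim l DIM('a) * zonal_mean u (gegenbauer_poly DIM('a) l * gegenbauer_poly DIM('a) l) = 1"
    (is "?\<alpha> l * ?h l = 1")
proof (cases l)
  case 0
  then show ?thesis
    by (simp add: harmonic_dim_def zonal_mean_1)
next
  case (Suc n)
  have "?\<alpha> (Suc n) * ?h (Suc n) = 1"
  proof (induction n)
    case 0
    have "zonal_moment u 0 0 = 1"
      using zonal_mean_1[of u] by (simp add: zonal_moment_def zonal_mean_def)
    then have "real DIM('a) * zonal_moment u 1 0 = 1"
      using zonal_moment_Suc[OF u, of 0 0] zonal_moment_split[of u 0 0] by (simp add: algebra_simps)
    moreover have "?h (Suc 0) = zonal_moment u 1 0"
      by (simp add: zonal_mean_def zonal_moment_def power2_eq_square)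
    ultimately show ?case
      by (simp add: harmonic_dim_def)
  next
    case (Suc n)
    define A where "A = real n + real DIM('a) - 1"
    define B where "B = 2 * real n + real DIM('a)"
    have pos: "A > 0" "B > 0"
      using d by (auto simp: A_def B_def)
    let ?G = "gegenbauer_poly DIM('a)"
    define c where "c = zonal_mean u ([:0, 1:] * (?G (Suc n) * ?G (Suc (Suc n))))"
    have 1: "B * c = A * ?h (Suc (Suc n))"
      using zonal_mean_X_times_gegenbauer[OF d, of n u "?G (Suc (Suc n))"]
        zonal_mean_gegenbauer_orthogonal[OF u d, of "Suc (Suc n)" n]
      by (simp add: A_def B_def c_def mult_ac del: mult_pCons_left mult_pCons_right gegenbauer_poly.simps)
    have 2: "(B + 2) * c = (real n + 2) * ?h (Suc n)"
      using zonal_mean_X_times_gegenbauer[OF d, of "Suc n" u "?G (Suc n)"]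
        zonal_mean_gegenbauer_orthogonal[OF u d, of "Suc n" "Suc (Suc (Suc n))"]
      by (simp add: B_def c_def algebra_simps del: mult_pCons_left mult_pCons_right gegenbauer_poly.simps)
    have 3: "(real n + 2) * B * ?\<alpha> (Suc (Suc n)) = (B + 2) * A * ?\<alpha> (Suc n)"
      using harmonic_dim_ratio[OF d, of n] by (simp add: A_def B_def)
    (* c is eliminated between the two evaluations; the common factor is positive *)
    have "((real n + 2) * B * (B + 2) * A) * (?\<alpha> (Suc (Suc n)) * ?h (Suc (Suc n)))
        = ((real n + 2) * B * ?\<alpha> (Suc (Suc n))) * (B + 2) * (A * ?h (Suc (Suc n)))"
      by (simp only: mult_ac)
    also have "\<dots> = (B + 2) * A * ?\<alpha> (Suc n) * B * ((B + 2) * c)"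
      unfolding 3 1[symmetric] by (simp only: mult_ac)
    also have "\<dots> = ((real n + 2) * B * (B + 2) * A) * (?\<alpha> (Suc n) * ?h (Suc n))"
      unfolding 2 by (simp only: mult_ac)
    finally show ?case
      using pos Suc.IH by (simp del: gegenbauer_poly.simps)
  qed
  then show ?thesis
    by (simp only: Suc)
qed

lemma gegenbauer_expansion:
  assumes d: "d \<ge> 2" and "\<And>i. i \<ge> n \<Longrightarrow> coeff p i = 0"
  shows "\<exists>r. p = (\<Sum>m<n. smult (r m) (gegenbauer_poly d m))"
  using assms(2)
proof (induction n arbitrary: p)
  case 0
  then have "p = 0"
    by (simp add: poly_eq_iff)
  then show ?case by simp
next
  case (Suc n)
  let ?G = "gegenbauer_poly d n"
  have lc: "coeff ?G n \<noteq> 0"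
    using degree_gegenbauer_poly[OF d, of n] poly_gegenbauer_poly[OF d, of n 1] gegenbauer_1[of d n]
    by (metis leading_coeff_0_iff poly_0 zero_neq_one)
  define q where "q = p - smult (coeff p n / coeff ?G n) ?G"
  have "coeff q i = 0" if "i \<ge> n" for i
  proof (cases "i = n")
    case False
    then have "coeff ?G i = 0" "coeff p i = 0"
      using that Suc.prems[of i] by (auto intro: coeff_eq_0 simp: degree_gegenbauer_poly[OF d])
    then show ?thesis by (simp add: q_def)
  qed (use lc in \<open>simp add: q_def\<close>)
  then obtain r where r: "q = (\<Sum>m<n. smult (r m) (gegenbauer_poly d m))"
    using Suc.IH by blast
  have "p = q + smult (coeff p n / coeff ?G n) ?G"
    by (simp add: q_def)
  also have "\<dots> = (\<Sum>m<Suc n. smult ((r(n := coeff p n / coeff ?G n)) m) (gegenbauer_poly d m))"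
    by (simp add: r)
  finally show ?case by blast
qed

text \<open>
  Gram-Schmidt: in the expansion of \<open>R\<close>, orthogonality removes all terms but the last, because the square
  norms do not vanish.
\<close>

lemma gegenbauer_unique:
  fixes u :: "'a::euclidean_space"
  assumes u: "norm u = 1" and d: "DIM('a) \<ge> 2" and R: "degree R \<le> l"
    and orth: "\<And>q. degree q < l \<Longrightarrow> zonal_mean u (R * q) = 0"
  shows "R = smult (poly R 1) (gegenbauer_poly DIM('a) l)"
proof -
  let ?G = "gegenbauer_poly DIM('a)"
  have "\<exists>r. R = (\<Sum>m<Suc l. smult (r m) (?G m))"
    using R by (intro gegenbauer_expansion[OF d] coeff_eq_0) linarith
  then obtain r where r: "R = (\<Sum>m<Suc l. smult (r m) (?G m))" ..
  have "r j = 0" if j: "j < l" for j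
  proof -
    have "0 = zonal_mean u (R * ?G j)"
      using orth[of "?G j"] j by (simp add: degree_gegenbauer_poly[OF d])
    also have "\<dots> = (\<Sum>m<Suc l. r m * zonal_mean u (?G m * ?G j))"
      unfolding r by (simp only: sum_distrib_right zonal_mean_sum zonal_mean_smult mult_smult_left)
    also have "\<dots> = (\<Sum>m<Suc l. if m = j then r j * zonal_mean u (?G j * ?G j) else 0)"
      by (intro sum.cong refl) (simp add: zonal_mean_gegenbauer_orthogonal[OF u d])
    also have "\<dots> = r j * zonal_mean u (?G j * ?G j)"
      using j by (subst sum.delta) auto
    finally show ?thesis
      using zonal_mean_gegenbauer_square[OF u d, of j] by auto
  qed
  then have R': "R = smult (r l) (?G l)"
    unfolding r by simp
  then have "poly R 1 = r l"
    by (metis gegenbauer_1 mult.right_neutral poly_gegenbauer_poly[OF d] poly_smult)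
  show ?thesis
    unfolding \<open>poly R 1 = r l\<close> by (rule R')
qed

section \<open>Convolution of zonal polynomials\<close>

text \<open>
  By invariance \<open>u\<close> may be taken to be a basis vector \<open>e\<close> and \<open>w\<close> to be \<open>t e + \<sigma> b\<close> with \<open>t = u \<bullet> w\<close> and
  \<open>\<sigma> = \<plusminus> sqrt (1 - t\<^sup>2)\<close>. The binomial theorem gives a polynomial in \<open>t\<close> and \<open>\<sigma>\<close>; averaging over the two
  signs removes the odd powers of \<open>\<sigma>\<close>, and the even ones are polynomials in \<open>t\<close>.
\<close>

lemma zonal_convolution_power:
  fixes p :: "real poly"
  assumes d: "DIM('a::euclidean_space) \<ge> 2"
  shows "\<exists>R. degree R \<le> k \<and> (\<forall>u w :: 'a. norm u = 1 \<longrightarrow> norm w = 1 \<longrightarrow>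
    (\<integral>v. poly p (u \<bullet> v) * (w \<bullet> v) ^ k \<partial>sphere_uniform) = poly R (u \<bullet> w))"
proof -
  obtain e :: 'a where e: "e \<in> Basis"
    using nonempty_Basis by blast
  have "Basis - {e} \<noteq> {}"
  proof
    assume "Basis - {e} = {}"
    then have "Basis = {e}" using e by blast
    then have "DIM('a) = card {e}" by (rule arg_cong)
    then show False using d by simp
  qed
  then obtain b where b: "b \<in> Basis" "b \<noteq> e" by blast
  have eb: "e \<bullet> e = 1" "b \<bullet> b = 1" "e \<bullet> b = 0" "b \<bullet> e = 0"
    using e b by (auto simp: inner_Basis)
  have [measurable]: "poly p \<in> borel_measurable borel"
    by (intro borel_measurable_continuous_onI continuous_intros)
  define A where "A j = (\<integral>v. poly p (e \<bullet> v) * (b \<bullet> v) ^ j * (e \<bullet> v) ^ (k - j) \<partial>sphere_uniform)" for j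
  define T where "T j = (if even j then smult (real (k choose j) * A j) ([:0, 1:] ^ (k - j) * [:1, 0, -1:] ^ (j div 2)) else 0)" for j
  define R where "R = (\<Sum>j\<le>k. T j)"
  have "degree R \<le> k"
    unfolding R_def
  proof (intro degree_sum_le)
    fix j assume "j \<in> {..k}"
    then have jk: "j \<le> k" by simp
    show "degree (T j) \<le> k"
    proof (cases "even j")
      case True
      have "degree ([:0, 1:] ^ (k - j) * [:1, 0, -1::real:] ^ (j div 2))
          \<le> degree ([:0, 1::real:] ^ (k - j)) + degree ([:1, 0, -1::real:] ^ (j div 2))"
        by (rule degree_mult_le)
      also have "\<dots> \<le> (k - j) + 2 * (j div 2)"
        using degree_power_le[of "[:0, 1::real:]" "k - j"] degree_power_le[of "[:1, 0, -1::real:]" "j div 2"]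
        by simp
      also have "\<dots> \<le> k"
        using jk True by simp
      finally show ?thesis
        using True by (auto simp: T_def intro: order_trans[OF degree_smult_le])
    qed (simp add: T_def)
  qed simp
  moreover have "(\<integral>v. poly p (u \<bullet> v) * (w \<bullet> v) ^ k \<partial>sphere_uniform) = poly R (u \<bullet> w)"
    if u: "norm u = 1" and w: "norm w = 1" for u w :: 'a
  proof -
    define t where "t = u \<bullet> w"
    define s where "s = sqrt (1 - t\<^sup>2)"
    define I where "I = (\<integral>v. poly p (u \<bullet> v) * (w \<bullet> v) ^ k \<partial>sphere_uniform)"
    have "\<bar>t\<bar> \<le> 1"
      using Cauchy_Schwarz_ineq2[of u w] u w by (simp add: t_def)
    then have s2: "s\<^sup>2 = 1 - t\<^sup>2"
      by (simp add: s_def abs_le_square_iff[of t 1, simplified])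
    have *: "I = (\<Sum>j\<le>k. real (k choose j) * A j * t ^ (k - j) * \<sigma> ^ j)" if "\<sigma>\<^sup>2 = 1 - t\<^sup>2" for \<sigma>
    proof -
      define z where "z = t *\<^sub>R e + \<sigma> *\<^sub>R b"
      have "z \<bullet> z = t\<^sup>2 + \<sigma>\<^sup>2"
        by (simp add: z_def inner_add_left inner_add_right eb power2_eq_square)
      then have z: "norm z = 1"
        by (simp add: norm_eq_1 that)
      have dot: "u \<bullet> w = e \<bullet> z"
        by (simp add: z_def inner_add_right eb t_def)
      have "I = (\<integral>v. poly p (e \<bullet> v) * (z \<bullet> v) ^ k \<partial>sphere_uniform)"
        unfolding I_def
        by (rule sphere_integral_pair_cong[where F = "\<lambda>x y. poly p x * y ^ k"])
          (use u w z dot in \<open>auto simp: norm_eq_1[of e] eb\<close>)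
      also have "\<dots> = (\<integral>v. (\<Sum>j\<le>k. (real (k choose j) * t ^ (k - j) * \<sigma> ^ j)
          * (poly p (e \<bullet> v) * (b \<bullet> v) ^ j * (e \<bullet> v) ^ (k - j))) \<partial>sphere_uniform)"
      proof (rule Bochner_Integration.integral_cong[OF refl])
        fix v
        have "z \<bullet> v = \<sigma> * (b \<bullet> v) + t * (e \<bullet> v)"
          by (simp add: z_def inner_add_left)
        then show "poly p (e \<bullet> v) * (z \<bullet> v) ^ k = (\<Sum>j\<le>k. (real (k choose j) * t ^ (k - j) * \<sigma> ^ j)
          * (poly p (e \<bullet> v) * (b \<bullet> v) ^ j * (e \<bullet> v) ^ (k - j)))"
          by (simp add: binomial_ring sum_distrib_left power_mult_distrib mult_ac)
      qed
      also have "\<dots> = (\<Sum>j\<le>k. (real (k choose j) * t ^ (k - j) * \<sigma> ^ j) * A j)"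
        unfolding A_def
        by (subst Bochner_Integration.integral_sum)
          (auto intro!: integrable_sphere_uniform continuous_intros)
      finally show ?thesis
        by (simp add: mult_ac)
    qed
    have "2 * I = (\<Sum>j\<le>k. real (k choose j) * A j * t ^ (k - j) * s ^ j)
        + (\<Sum>j\<le>k. real (k choose j) * A j * t ^ (k - j) * (- s) ^ j)"
      using *[of s] *[of "- s"] s2 by simp
    also have "\<dots> = (\<Sum>j\<le>k. 2 * poly (T j) t)"
      unfolding sum.distrib[symmetric]
    proof (rule sum.cong[OF refl])
      fix j
      show "real (k choose j) * A j * t ^ (k - j) * s ^ j + real (k choose j) * A j * t ^ (k - j) * (- s) ^ j
        = 2 * poly (T j) t"
      proof (cases "even j")
        case True
        then obtain i where i: "j = 2 * i" by blast
        have "s ^ j = (1 - t\<^sup>2) ^ i"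
          by (simp add: i power_mult s2)
        then show ?thesis
          using True by (simp add: T_def i power2_eq_square)
      qed (simp add: T_def)
    qed
    also have "\<dots> = 2 * poly R t"
      by (simp add: R_def poly_sum sum_distrib_left)
    finally show ?thesis
      by (simp add: I_def t_def)
  qed
  ultimately show ?thesis by blast
qed

lemma zonal_convolution:
  fixes p q :: "real poly"
  assumes d: "DIM('a::euclidean_space) \<ge> 2"
  obtains R where "degree R \<le> degree q"
    "\<And>u w :: 'a. norm u = 1 \<Longrightarrow> norm w = 1 \<Longrightarrow>
      (\<integral>v. poly p (u \<bullet> v) * poly q (w \<bullet> v) \<partial>sphere_uniform) = poly R (u \<bullet> w)"
proof -
  obtain S where S: "\<And>k. degree (S k) \<le> k" "\<And>k (u::'a) w. norm u = 1 \<Longrightarrow> norm w = 1 \<Longrightarrow>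
      (\<integral>v. poly p (u \<bullet> v) * (w \<bullet> v) ^ k \<partial>sphere_uniform) = poly (S k) (u \<bullet> w)"
    using zonal_convolution_power[OF d, of _ p] by metis
  define R where "R = (\<Sum>i\<le>degree q. smult (coeff q i) (S i))"
  have "degree R \<le> degree q"
    unfolding R_def by (intro degree_sum_le order_trans[OF degree_smult_le] order_trans[OF S(1)]) auto
  moreover have "(\<integral>v. poly p (u \<bullet> v) * poly q (w \<bullet> v) \<partial>sphere_uniform) = poly R (u \<bullet> w)"
    if "norm u = 1" "norm w = 1" for u w :: 'a
  proof -
    have "(\<integral>v. poly p (u \<bullet> v) * poly q (w \<bullet> v) \<partial>sphere_uniform)
      = (\<integral>v. (\<Sum>i\<le>degree q. coeff q i * (poly p (u \<bullet> v) * (w \<bullet> v) ^ i)) \<partial>sphere_uniform)"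
      by (simp add: poly_altdef sum_distrib_left mult_ac)
    also have "\<dots> = (\<Sum>i\<le>degree q. coeff q i * (\<integral>v. poly p (u \<bullet> v) * (w \<bullet> v) ^ i \<partial>sphere_uniform))"
      by (subst Bochner_Integration.integral_sum)
        (auto intro!: integrable_sphere_uniform continuous_intros)
    finally show ?thesis
      by (simp add: S(2) that R_def poly_sum)
  qed
  ultimately show ?thesis
    using that by blast
qed

lemma continuous_bounded_on_sphere:
  fixes F :: "'a::euclidean_space \<Rightarrow> 'a \<Rightarrow> real"
  assumes "continuous_on UNIV (case_prod F)"
  obtains B where "\<And>x y. norm x = 1 \<Longrightarrow> norm y = 1 \<Longrightarrow> \<bar>F x y\<bar> \<le> B"
proof -
  have "compact (case_prod F ` (sphere 0 1 \<times> sphere 0 1))"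
    by (intro compact_continuous_image continuous_on_subset[OF assms] compact_Times) auto
  then obtain B where B: "\<forall>z\<in>case_prod F ` (sphere 0 1 \<times> sphere 0 1). norm z \<le> B"
    using compact_imp_bounded bounded_iff by blast
  have "\<bar>F x y\<bar> \<le> B" if "norm x = 1" "norm y = 1" for x y
    using that B[rule_format, of "F x y"] by (force simp: image_iff)
  then show ?thesis
    by (rule that)
qed

lemma borel_measurable_sphere_pair:
  fixes F :: "'a::euclidean_space \<Rightarrow> 'a \<Rightarrow> real"
  assumes F: "continuous_on UNIV (case_prod F)"
  shows "case_prod F \<in> borel_measurable (sphere_uniform \<Otimes>\<^sub>M sphere_uniform)"
proof -
  let ?S = "sphere_uniform :: 'a measure"
  have [measurable]: "(\<lambda>x. x) \<in> measurable ?S borel"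
    unfolding measurable_cong_sets[OF sets_sphere_uniform refl] by (rule measurable_restrict_space1) simp
  have "(\<lambda>z. (fst z, snd z)) \<in> measurable (?S \<Otimes>\<^sub>M ?S) (borel \<Otimes>\<^sub>M borel)"
    by measurable
  moreover have "case_prod F \<in> borel_measurable (borel \<Otimes>\<^sub>M borel)"
    unfolding borel_prod using F by (rule borel_measurable_continuous_onI)
  ultimately show ?thesis
    using measurable_compose by force
qed

text \<open>
  The factor \<open>g\<close> is separate because it is only integrable, while \<open>F\<close> is bounded on the sphere.
\<close>

lemma sphere_Fubini:
  fixes F :: "'a::euclidean_space \<Rightarrow> 'a \<Rightarrow> real"
  assumes F: "continuous_on UNIV (case_prod F)" and g: "integrable sphere_uniform g"
  shows "(\<integral>x. (\<integral>y. F x y * g y \<partial>sphere_uniform) \<partial>sphere_uniform)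
    = (\<integral>y. (\<integral>x. F x y * g y \<partial>sphere_uniform) \<partial>sphere_uniform)"
proof -
  let ?S = "sphere_uniform :: 'a measure"
  interpret S: prob_space ?S
    by (rule prob_space_sphere_uniform)
  interpret pair_sigma_finite ?S ?S ..
  note [measurable] = borel_measurable_integrable[OF g]
  obtain B where B: "\<And>x y. norm x = 1 \<Longrightarrow> norm y = 1 \<Longrightarrow> \<bar>F x y\<bar> \<le> B"
    using continuous_bounded_on_sphere[OF F] by metis
  have [measurable]: "(\<lambda>z. F (fst z) (snd z)) \<in> borel_measurable (?S \<Otimes>\<^sub>M ?S)"
    using borel_measurable_sphere_pair[OF F] by (simp add: case_prod_unfold)
  have "integrable (?S \<Otimes>\<^sub>M ?S) (\<lambda>z. g (snd z))"
    using g by (intro Fubini_integrable) (auto simp: S.emeasure_space_1)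
  then have "integrable (?S \<Otimes>\<^sub>M ?S) (\<lambda>z. B * g (snd z))"
    by simp
  then have "integrable (?S \<Otimes>\<^sub>M ?S) (\<lambda>z. F (fst z) (snd z) * g (snd z))"
  proof (rule Bochner_Integration.integrable_bound)
    show "AE z in ?S \<Otimes>\<^sub>M ?S. norm (F (fst z) (snd z) * g (snd z)) \<le> norm (B * g (snd z))"
    proof (rule AE_I2)
      fix z assume "z \<in> space (?S \<Otimes>\<^sub>M ?S)"
      then have "\<bar>F (fst z) (snd z)\<bar> \<le> B"
        by (auto simp: space_pair_measure space_sphere_uniform intro!: B)
      then show "norm (F (fst z) (snd z) * g (snd z)) \<le> norm (B * g (snd z))"
        by (auto simp: abs_mult intro!: mult_right_mono)
    qed
  qed measurable
  then show ?thesis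
    using Fubini_integral[of "\<lambda>x y. F x y * g y"] by (simp add: case_prod_unfold)
qed

text \<open>
  The Funk-Hecke formula for polynomials. Let \<open>R\<close> be the convolution of \<open>p\<close> with \<open>P\<^sub>l\<close>, of degree at most
  \<open>l\<close>. Against a test polynomial \<open>q\<close> of degree below \<open>l\<close>, Fubini moves the convolution with \<open>p\<close> from \<open>P\<^sub>l\<close> to
  \<open>q\<close>; the result has degree below \<open>l\<close> again, so it is orthogonal to \<open>P\<^sub>l\<close>. Hence \<open>R\<close> is a multiple of
  \<open>P\<^sub>l\<close>, and \<open>w = u\<close> determines the factor.
\<close>

theorem funk_hecke:
  fixes u w :: "'a::euclidean_space" and p :: "real poly"
  assumes u: "norm u = 1" and w: "norm w = 1" and d: "DIM('a) \<ge> 2"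
  shows "(\<integral>v. poly p (u \<bullet> v) * poly (gegenbauer_poly DIM('a) l) (w \<bullet> v) \<partial>sphere_uniform)
    = zonal_mean u (p * gegenbauer_poly DIM('a) l) * poly (gegenbauer_poly DIM('a) l) (u \<bullet> w)"
proof -
  let ?G = "gegenbauer_poly DIM('a) l"
  have [measurable]: "poly r \<in> borel_measurable borel" for r :: "real poly"
    by (intro borel_measurable_continuous_onI continuous_intros)
  obtain R where R: "degree R \<le> degree ?G" "\<And>x y :: 'a. norm x = 1 \<Longrightarrow> norm y = 1 \<Longrightarrow>
      (\<integral>v. poly p (x \<bullet> v) * poly ?G (y \<bullet> v) \<partial>sphere_uniform) = poly R (x \<bullet> y)"
    using zonal_convolution[OF d, of ?G p] by blast
  have "R = smult (poly R 1) ?G"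
  proof (rule gegenbauer_unique[OF u d])
    show "degree R \<le> l"
      using R(1) by (simp add: degree_gegenbauer_poly[OF d])
    fix q :: "real poly" assume q: "degree q < l"
    obtain Q where Q: "degree Q \<le> degree q" "\<And>x y :: 'a. norm x = 1 \<Longrightarrow> norm y = 1 \<Longrightarrow>
        (\<integral>v. poly p (x \<bullet> v) * poly q (y \<bullet> v) \<partial>sphere_uniform) = poly Q (x \<bullet> y)"
      using zonal_convolution[OF d, of q p] by blast
    have "zonal_mean u (R * q)
        = (\<integral>x. (\<integral>y. poly p (x \<bullet> y) * poly ?G (u \<bullet> y) * poly q (u \<bullet> x) * 1 \<partial>sphere_uniform) \<partial>sphere_uniform)"
      unfolding zonal_mean_def
    proof (rule Bochner_Integration.integral_cong[OF refl])
      fix x :: 'a assume "x \<in> space sphere_uniform"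
      then have x: "norm x = 1"
        by (simp add: space_sphere_uniform)
      have "poly R (u \<bullet> x) = (\<integral>y. poly p (x \<bullet> y) * poly ?G (u \<bullet> y) \<partial>sphere_uniform)"
        using R(2)[OF x u] by (simp add: inner_commute)
      then show "poly (R * q) (u \<bullet> x)
          = (\<integral>y. poly p (x \<bullet> y) * poly ?G (u \<bullet> y) * poly q (u \<bullet> x) * 1 \<partial>sphere_uniform)"
        by simp
    qed
    also have "\<dots> = (\<integral>y. (\<integral>x. poly p (x \<bullet> y) * poly ?G (u \<bullet> y) * poly q (u \<bullet> x) * 1 \<partial>sphere_uniform) \<partial>sphere_uniform)"
      by (rule sphere_Fubini)
        (auto intro!: integrable_sphere_uniform continuous_intros simp: case_prod_unfold)
    also have "\<dots> = (\<integral>y. poly (Q * ?G) (u \<bullet> y) \<partial>sphere_uniform)"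
    proof (rule Bochner_Integration.integral_cong[OF refl])
      fix y :: 'a assume "y \<in> space sphere_uniform"
      then have y: "norm y = 1"
        by (simp add: space_sphere_uniform)
      have "(\<integral>x. poly p (x \<bullet> y) * poly ?G (u \<bullet> y) * poly q (u \<bullet> x) * 1 \<partial>sphere_uniform)
          = (\<integral>x. poly ?G (u \<bullet> y) * (poly p (y \<bullet> x) * poly q (u \<bullet> x)) \<partial>sphere_uniform)"
        by (simp add: inner_commute mult_ac)
      also have "\<dots> = poly ?G (u \<bullet> y) * poly Q (y \<bullet> u)"
        by (simp add: Q(2)[OF y u])
      finally show "(\<integral>x. poly p (x \<bullet> y) * poly ?G (u \<bullet> y) * poly q (u \<bullet> x) * 1 \<partial>sphere_uniform)
          = poly (Q * ?G) (u \<bullet> y)"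
        by (simp add: inner_commute)
    qed
    also have "\<dots> = zonal_mean u (Q * ?G)"
      by (simp add: zonal_mean_def)
    also have "\<dots> = 0"
      using Q(1) q by (intro zonal_mean_times_gegenbauer_eq_0[OF u d]) simp
    finally show "zonal_mean u (R * q) = 0" .
  qed
  moreover have "poly R 1 = zonal_mean u (p * ?G)"
    using R(2)[OF u u] u by (simp add: zonal_mean_def norm_eq_1)
  ultimately show ?thesis
    using R(2)[OF u w] by (metis poly_smult)
qed

section \<open>The reproducing kernel\<close>

definition harmonic_kernel :: "nat \<Rightarrow> nat \<Rightarrow> real poly" where
  "harmonic_kernel d q = (\<Sum>l = 0..q. smult (harmonic_dim l d) (gegenbauer_poly d l))"

lemma harmonic_kernel_1:
  assumes "d \<ge> 2"
  shows "poly (harmonic_kernel d q) 1 = (\<Sum>l = 0..q. harmonic_dim l d)"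
  by (simp add: harmonic_kernel_def poly_sum poly_gegenbauer_poly[OF assms] gegenbauer_1)

text \<open>
  Every \<open>P\<^sub>l\<close> with \<open>l \<le> q\<close> is an eigenvector of the convolution with the kernel, with eigenvalue
  \<open>\<alpha>\<^sub>l\<close> times its square norm, which is \<open>1\<close>.
\<close>

lemma harmonic_kernel_reproducing:
  fixes u w :: "'a::euclidean_space"
  assumes u: "norm u = 1" and w: "norm w = 1" and d: "DIM('a) \<ge> 2"
  shows "(\<integral>v. poly (harmonic_kernel DIM('a) q) (u \<bullet> v) * poly (harmonic_kernel DIM('a) q) (w \<bullet> v) \<partial>sphere_uniform)
    = poly (harmonic_kernel DIM('a) q) (u \<bullet> w)"
proof -
  let ?Z = "harmonic_kernel DIM('a) q" and ?G = "gegenbauer_poly DIM('a)" and ?\<alpha> = "\<lambda>l. harmonic_dim l DIM('a)"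
  have ZG: "zonal_mean u (?Z * ?G l) = 1" if l: "l \<le> q" for l
  proof -
    have "zonal_mean u (?Z * ?G l) = (\<Sum>m = 0..q. ?\<alpha> m * zonal_mean u (?G m * ?G l))"
      by (simp add: harmonic_kernel_def sum_distrib_right zonal_mean_sum zonal_mean_smult)
    also have "\<dots> = (\<Sum>m = 0..q. if m = l then ?\<alpha> l * zonal_mean u (?G l * ?G l) else 0)"
      by (intro sum.cong refl) (simp add: zonal_mean_gegenbauer_orthogonal[OF u d])
    also have "\<dots> = 1"
      using l by (simp add: zonal_mean_gegenbauer_square[OF u d])
    finally show ?thesis .
  qed
  have "(\<integral>v. poly ?Z (u \<bullet> v) * poly ?Z (w \<bullet> v) \<partial>sphere_uniform)
      = (\<integral>v. (\<Sum>l = 0..q. ?\<alpha> l * (poly ?Z (u \<bullet> v) * poly (?G l) (w \<bullet> v))) \<partial>sphere_uniform)"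
    by (subst (2) harmonic_kernel_def) (simp add: poly_sum sum_distrib_left mult_ac)
  also have "\<dots> = (\<Sum>l = 0..q. ?\<alpha> l * (\<integral>v. poly ?Z (u \<bullet> v) * poly (?G l) (w \<bullet> v) \<partial>sphere_uniform))"
    by (subst Bochner_Integration.integral_sum) (auto intro!: integrable_sphere_uniform continuous_intros)
  also have "\<dots> = (\<Sum>l = 0..q. ?\<alpha> l * poly (?G l) (u \<bullet> w))"
    by (intro sum.cong refl) (simp add: funk_hecke[OF u w d] ZG)
  also have "\<dots> = poly ?Z (u \<bullet> w)"
    by (simp add: harmonic_kernel_def poly_sum)
  finally show ?thesis .
qed

section \<open>The leverage function\<close>

lemma sphere_L2_integrable:
  fixes g :: "'a::euclidean_space \<Rightarrow> real"
  assumes "g \<in> sphere_L2"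
  shows "integrable sphere_uniform g"
proof -
  interpret prob_space "sphere_uniform :: 'a measure"
    by (rule prob_space_sphere_uniform)
  show ?thesis
    by (rule square_integrable_imp_integrable) (use assms in \<open>simp_all add: sphere_L2_def\<close>)
qed

lemma integrable_sphere_uniform_mult:
  fixes F g :: "'a::euclidean_space \<Rightarrow> real"
  assumes F: "continuous_on UNIV F" and g: "integrable sphere_uniform g"
  shows "integrable sphere_uniform (\<lambda>v. F v * g v)"
proof -
  have "continuous_on UNIV (\<lambda>(x, y :: 'a). F x)"
    unfolding case_prod_unfold by (intro continuous_on_compose2[OF F] continuous_intros) auto
  then obtain B where B: "\<And>x y :: 'a. norm x = 1 \<Longrightarrow> norm y = 1 \<Longrightarrow> \<bar>F x\<bar> \<le> B"
    by (rule continuous_bounded_on_sphere) metis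
  have [measurable]: "F \<in> borel_measurable sphere_uniform" "g \<in> borel_measurable sphere_uniform"
    using F g by (auto intro: measurable_sphere_uniform borel_measurable_continuous_onI)
  have "integrable sphere_uniform (\<lambda>v. B * g v)"
    using g by simp
  then show ?thesis
  proof (rule Bochner_Integration.integrable_bound)
    show "AE v in sphere_uniform. norm (F v * g v) \<le> norm (B * g v)"
    proof (rule AE_I2)
      fix v :: 'a assume "v \<in> space sphere_uniform"
      then have "\<bar>F v\<bar> \<le> B"
        using B[of v v] by (simp add: space_sphere_uniform)
      then show "norm (F v * g v) \<le> norm (B * g v)"
        by (auto simp: abs_mult intro!: mult_right_mono)
    qed
  qed measurable
qed

lemma harmonic_op_eq:
  fixes g :: "'a::euclidean_space \<Rightarrow> real"
  assumes g: "integrable sphere_uniform g" and d: "DIM('a) \<ge> 2"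
  shows "harmonic_op q g x = (\<integral>v. poly (harmonic_kernel DIM('a) q) (x \<bullet> v) * g v \<partial>sphere_uniform)"
proof -
  have "(\<integral>v. poly (harmonic_kernel DIM('a) q) (x \<bullet> v) * g v \<partial>sphere_uniform)
      = (\<integral>v. (\<Sum>l = 0..q. harmonic_dim l DIM('a) * (poly (gegenbauer_poly DIM('a) l) (x \<bullet> v) * g v)) \<partial>sphere_uniform)"
    by (simp add: harmonic_kernel_def poly_sum sum_distrib_right mult.assoc)
  also have "\<dots> = (\<Sum>l = 0..q. harmonic_dim l DIM('a) * (\<integral>v. poly (gegenbauer_poly DIM('a) l) (x \<bullet> v) * g v \<partial>sphere_uniform))"
    by (subst Bochner_Integration.integral_sum)
      (auto intro!: integrable_sphere_uniform_mult g continuous_intros Bochner_Integration.integrable_mult_right)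
  finally show ?thesis
    by (simp add: harmonic_op_def poly_gegenbauer_poly[OF d] mult.commute)
qed

lemma harmonic_op_borel_measurable:
  fixes g :: "'a::euclidean_space \<Rightarrow> real"
  assumes g: "integrable sphere_uniform g" and d: "DIM('a) \<ge> 2"
  shows "harmonic_op q g \<in> borel_measurable sphere_uniform"
proof -
  let ?S = "sphere_uniform :: 'a measure"
  interpret S: prob_space ?S
    by (rule prob_space_sphere_uniform)
  have [measurable]: "(\<lambda>(x, v). poly (harmonic_kernel DIM('a) q) (x \<bullet> v)) \<in> borel_measurable (?S \<Otimes>\<^sub>M ?S)"
    by (rule borel_measurable_sphere_pair) (auto simp: case_prod_unfold intro!: continuous_intros)
  note [measurable] = borel_measurable_integrable[OF g]
  show ?thesis
    unfolding harmonic_op_eq[OF g d, abs_def] by measurable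
qed

lemma harmonic_op_bounded:
  fixes g :: "'a::euclidean_space \<Rightarrow> real"
  assumes g: "integrable sphere_uniform g" and d: "DIM('a) \<ge> 2"
  obtains C where "\<And>x. norm x = 1 \<Longrightarrow> \<bar>harmonic_op q g x\<bar> \<le> C"
proof -
  let ?Z = "\<lambda>x v :: 'a. poly (harmonic_kernel DIM('a) q) (x \<bullet> v)"
  have "continuous_on UNIV (\<lambda>(x, v). ?Z x v)"
    by (auto simp: case_prod_unfold intro!: continuous_intros)
  then obtain B where B: "\<And>x v. norm x = 1 \<Longrightarrow> norm v = 1 \<Longrightarrow> \<bar>?Z x v\<bar> \<le> B"
    by (rule continuous_bounded_on_sphere) metis
  have "\<bar>harmonic_op q g x\<bar> \<le> (\<integral>v. B * \<bar>g v\<bar> \<partial>sphere_uniform)" if x: "norm x = 1" for x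
  proof -
    have int: "integrable sphere_uniform (\<lambda>v. ?Z x v * g v)"
      by (intro integrable_sphere_uniform_mult g continuous_intros)
    have "\<bar>harmonic_op q g x\<bar> \<le> (\<integral>v. \<bar>?Z x v * g v\<bar> \<partial>sphere_uniform)"
      unfolding harmonic_op_eq[OF g d] by (rule integral_abs_bound)
    also have "\<dots> \<le> (\<integral>v. B * \<bar>g v\<bar> \<partial>sphere_uniform)"
    proof (rule integral_mono[OF integrable_abs[OF int]])
      show "integrable sphere_uniform (\<lambda>v. B * \<bar>g v\<bar>)"
        using g by simp
      fix v :: 'a assume "v \<in> space sphere_uniform"
      then show "\<bar>?Z x v * g v\<bar> \<le> B * \<bar>g v\<bar>"
        using x B[of x v] by (auto simp: abs_mult space_sphere_uniform intro!: mult_right_mono)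
    qed
    finally show ?thesis .
  qed
  then show ?thesis
    by (rule that)
qed

lemma integrable_harmonic_op:
  fixes g :: "'a::euclidean_space \<Rightarrow> real"
  assumes g: "integrable sphere_uniform g" and d: "DIM('a) \<ge> 2"
  shows "integrable sphere_uniform (\<lambda>x. (harmonic_op q g x)\<^sup>2)"
    and "integrable sphere_uniform (harmonic_op q g)"
proof -
  let ?S = "sphere_uniform :: 'a measure"
  interpret S: prob_space ?S
    by (rule prob_space_sphere_uniform)
  note [measurable] = harmonic_op_borel_measurable[OF g d]
  obtain C where C: "\<And>x. norm x = 1 \<Longrightarrow> \<bar>harmonic_op q g x\<bar> \<le> C"
    using harmonic_op_bounded[OF g d] by metis
  show sq: "integrable ?S (\<lambda>x. (harmonic_op q g x)\<^sup>2)"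
  proof (rule S.integrable_const_bound)
    show "AE x in ?S. norm ((harmonic_op q g x)\<^sup>2) \<le> C\<^sup>2"
    proof (rule AE_I2)
      fix x :: 'a assume "x \<in> space ?S"
      then have "\<bar>harmonic_op q g x\<bar> \<le> C"
        by (simp add: C space_sphere_uniform)
      then have "\<bar>harmonic_op q g x\<bar>\<^sup>2 \<le> C\<^sup>2"
        by (intro power_mono) auto
      then show "norm ((harmonic_op q g x)\<^sup>2) \<le> C\<^sup>2"
        by simp
    qed
  qed measurable
  show "integrable ?S (harmonic_op q g)"
    using S.square_integrable_imp_integrable[OF _ sq] by simp
qed

lemma harmonic_op_reproducing:
  fixes g :: "'a::euclidean_space \<Rightarrow> real"
  assumes g: "integrable sphere_uniform g" and d: "DIM('a) \<ge> 2" and w: "norm w = 1"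
  shows "(\<integral>x. poly (harmonic_kernel DIM('a) q) (w \<bullet> x) * harmonic_op q g x \<partial>sphere_uniform) = harmonic_op q g w"
proof -
  let ?Z = "\<lambda>x v :: 'a. poly (harmonic_kernel DIM('a) q) (x \<bullet> v)"
  have "(\<integral>x. ?Z w x * harmonic_op q g x \<partial>sphere_uniform)
      = (\<integral>x. (\<integral>v. (?Z w x * ?Z x v) * g v \<partial>sphere_uniform) \<partial>sphere_uniform)"
    by (simp add: harmonic_op_eq[OF g d] mult.assoc)
  also have "\<dots> = (\<integral>v. (\<integral>x. (?Z w x * ?Z x v) * g v \<partial>sphere_uniform) \<partial>sphere_uniform)"
    by (rule sphere_Fubini[OF _ g]) (auto simp: case_prod_unfold intro!: continuous_intros)
  also have "\<dots> = (\<integral>v. ?Z w v * g v \<partial>sphere_uniform)"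
  proof (rule Bochner_Integration.integral_cong[OF refl])
    fix v :: 'a assume "v \<in> space sphere_uniform"
    then have "norm v = 1"
      by (simp add: space_sphere_uniform)
    then show "(\<integral>x. (?Z w x * ?Z x v) * g v \<partial>sphere_uniform) = ?Z w v * g v"
      using harmonic_kernel_reproducing[OF w _ d, of v q] by (simp add: inner_commute[of _ v])
  qed
  finally show ?thesis
    by (simp add: harmonic_op_eq[OF g d])
qed

text \<open>
  Cauchy-Schwarz for \<open>harmonic_op q g\<close> and the kernel function at \<open>w\<close>, whose inner product is the value
  at \<open>w\<close>.
\<close>

lemma harmonic_op_pointwise_bound:
  fixes g :: "'a::euclidean_space \<Rightarrow> real"
  assumes g: "integrable sphere_uniform g" and d: "DIM('a) \<ge> 2" and w: "norm w = 1"
  shows "(harmonic_op q g w)\<^sup>2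
    \<le> (\<Sum>l = 0..q. harmonic_dim l DIM('a)) * (\<integral>x. (harmonic_op q g x)\<^sup>2 \<partial>sphere_uniform)"
proof -
  define S where "S = (\<Sum>l = 0..q. harmonic_dim l DIM('a))"
  define h where "h = harmonic_op q g"
  define k where "k x = poly (harmonic_kernel DIM('a) q) (w \<bullet> x)" for x
  have ww: "w \<bullet> w = 1"
    using w by (simp add: norm_eq_1)
  have S: "S > 0"
    unfolding S_def using harmonic_dim_pos[OF d] by (intro sum_pos) auto
  have kk: "(\<integral>x. k x * k x \<partial>sphere_uniform) = S"
    using harmonic_kernel_reproducing[OF w w d, of q] harmonic_kernel_1[OF d, of q]
    by (simp add: k_def S_def ww)
  have kh: "(\<integral>x. k x * h x \<partial>sphere_uniform) = h w"
    using harmonic_op_reproducing[OF g d w] by (simp add: k_def h_def)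
  have cont: "continuous_on UNIV k"
    unfolding k_def by (intro continuous_intros)
  have int: "integrable sphere_uniform (\<lambda>x. (h x)\<^sup>2)"
    unfolding h_def by (rule integrable_harmonic_op(1)[OF g d])
  have int': "integrable sphere_uniform (\<lambda>x. k x * h x)"
    unfolding h_def by (rule integrable_sphere_uniform_mult[OF cont integrable_harmonic_op(2)[OF g d]])
  have int'': "integrable sphere_uniform (\<lambda>x. k x * k x)"
    using cont by (intro integrable_sphere_uniform continuous_intros)
  (* h w / S is the coefficient of the projection of h onto k; multiplied by S to avoid division *)
  have "0 \<le> (\<integral>x. (S * h x - h w * k x)\<^sup>2 \<partial>sphere_uniform)"
    by (intro integral_nonneg_AE) auto
  also have "\<dots> = (\<integral>x. S\<^sup>2 * (h x)\<^sup>2 - (2 * S * h w) * (k x * h x) + (h w)\<^sup>2 * (k x * k x) \<partial>sphere_uniform)"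
    by (simp add: power2_eq_square algebra_simps)
  also have "\<dots> = S\<^sup>2 * (\<integral>x. (h x)\<^sup>2 \<partial>sphere_uniform) - (2 * S * h w) * h w + (h w)\<^sup>2 * S"
    using int int' int'' by (simp add: kh kk)
  also have "\<dots> = S * (S * (\<integral>x. (h x)\<^sup>2 \<partial>sphere_uniform) - (h w)\<^sup>2)"
    by (simp add: power2_eq_square algebra_simps)
  finally show ?thesis
    using S by (simp add: zero_le_mult_iff S_def[symmetric] h_def[symmetric])
qed

lemma sphere_area_pos: "d > 0 \<Longrightarrow> sphere_area d > 0"
  unfolding sphere_area_def by (intro divide_pos_pos mult_pos_pos Gamma_real_pos) auto

lemma sphere_norm_powi:
  fixes f :: "'a::euclidean_space \<Rightarrow> real"
  shows "sphere_norm f powi (-2) = 1 / (sphere_area DIM('a) * (\<integral>x. (f x)\<^sup>2 \<partial>sphere_uniform))"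
proof -
  have "0 \<le> sphere_area DIM('a) * (\<integral>x. (f x)\<^sup>2 \<partial>sphere_uniform)"
    by (intro mult_nonneg_nonneg integral_nonneg_AE less_imp_le[OF sphere_area_pos]) auto
  then show ?thesis
    by (simp add: sphere_norm_def sphere_inner_def power2_eq_square power_int_minus field_simps)
qed

text \<open>
  The kernel function at \<open>w\<close> is the extremal function: the operator fixes it, and its square norm and
  its value at \<open>w\<close> are both the sum of the dimensions.
\<close>

theorem leverage_values_max:
  fixes w :: "'a::euclidean_space" and q :: nat
  assumes d: "DIM('a) \<ge> 2" and w: "norm w = 1"
  defines "m \<equiv> (\<Sum>l = 0..q. harmonic_dim l DIM('a)) / sphere_area DIM('a)"
  shows "m \<in> leverage_values q w" and "\<And>t. t \<in> leverage_values q w \<Longrightarrow> t \<le> m"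
proof -
  define S where "S = (\<Sum>l = 0..q. harmonic_dim l DIM('a))"
  define a where "a = sphere_area DIM('a)"
  have a: "a > 0"
    unfolding a_def by (rule sphere_area_pos) simp
  have S: "S > 0"
    unfolding S_def using harmonic_dim_pos[OF d] by (intro sum_pos) auto
  have m: "m = S / a"
    by (simp add: m_def S_def a_def)
  define k where "k x = poly (harmonic_kernel DIM('a) q) (w \<bullet> x)" for x
  have cont: "continuous_on UNIV k"
    unfolding k_def by (intro continuous_intros)
  have k: "integrable sphere_uniform k"
    by (rule integrable_sphere_uniform[OF cont])
  have kL2: "k \<in> sphere_L2"
    unfolding sphere_L2_def using k cont by (auto intro!: integrable_sphere_uniform continuous_intros)
  have opk: "harmonic_op q k x = k x" if "norm x = 1" for x
    using harmonic_kernel_reproducing[OF that w d, of q]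
    by (simp add: harmonic_op_eq[OF k d] k_def inner_commute[of x w])
  have kw: "k w = S"
    using w harmonic_kernel_1[OF d, of q] by (simp add: k_def S_def norm_eq_1)
  have k2: "(\<integral>x. (harmonic_op q k x)\<^sup>2 \<partial>sphere_uniform) = S"
  proof -
    have "(\<integral>x. (harmonic_op q k x)\<^sup>2 \<partial>sphere_uniform) = (\<integral>x. k x * k x \<partial>sphere_uniform)"
      by (intro Bochner_Integration.integral_cong refl)
        (simp add: space_sphere_uniform opk power2_eq_square)
    also have "\<dots> = k w"
      using harmonic_kernel_reproducing[OF w w d, of q] by (simp add: k_def)
    finally show ?thesis
      by (simp add: kw)
  qed
  have "\<not> (AE x in sphere_uniform. harmonic_op q k x = 0)"
  proof
    assume "AE x in sphere_uniform. harmonic_op q k x = 0"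
    then have "(\<integral>x. (harmonic_op q k x)\<^sup>2 \<partial>sphere_uniform) = 0"
      by (intro integral_eq_zero_AE) auto
    then show False
      using S k2 by simp
  qed
  moreover have "m = sphere_norm (harmonic_op q k) powi (-2) * \<bar>harmonic_op q k w\<bar>\<^sup>2"
    unfolding sphere_norm_powi k2 opk[OF w] kw m a_def[symmetric]
    using S a by (simp add: power2_eq_square)
  ultimately show "m \<in> leverage_values q w"
    unfolding leverage_values_def using kL2 by blast
  fix t assume "t \<in> leverage_values q w"
  then obtain g where g: "g \<in> sphere_L2"
      and t: "t = sphere_norm (harmonic_op q g) powi (-2) * \<bar>harmonic_op q g w\<bar>\<^sup>2"
    unfolding leverage_values_def by blast
  define I where "I = (\<integral>x. (harmonic_op q g x)\<^sup>2 \<partial>sphere_uniform)"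
  have I: "I \<ge> 0"
    unfolding I_def by (intro integral_nonneg_AE) auto
  have "(harmonic_op q g w)\<^sup>2 \<le> S * I"
    unfolding S_def I_def by (rule harmonic_op_pointwise_bound[OF sphere_L2_integrable[OF g] d w])
  then show "t \<le> m"
    using a S I by (cases "I = 0") (simp_all add: t m sphere_norm_powi I_def[symmetric] a_def[symmetric] field_simps)
qed

theorem lemma11:
  fixes w :: "real ^ 'n" and d q :: nat
  assumes "CARD('n) = d" and "d \<ge> 2"
    and "w \<in> sphere 0 1"
  shows "(\<exists>m \<in> leverage_values q w. \<forall>t \<in> leverage_values q w. t \<le> m)
    \<and> leverage q w = (\<Sum>l = 0..q. harmonic_dim l d / sphere_area d)"
proof -
  have d: "DIM(real ^ 'n) = d"
    using assms(1) by simp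
  have d2: "DIM(real ^ 'n) \<ge> 2" and w: "norm w = 1"
    using assms by simp_all
  define m where "m = (\<Sum>l = 0..q. harmonic_dim l d) / sphere_area d"
  have mem: "m \<in> leverage_values q w"
    using leverage_values_max(1)[OF d2 w, of q] unfolding d m_def .
  have max: "t \<le> m" if "t \<in> leverage_values q w" for t
    using leverage_values_max(2)[OF d2 w that] unfolding d m_def .
  have "leverage q w = m"
    unfolding leverage_def by (intro Greatest_equality mem max)
  then show ?thesis
    using mem max unfolding m_def sum_divide_distrib by blast
qed

end
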